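(* Let $n\ge 1$ be an integer, $p>1$, and $f=f(r,u)\in C^1([0,1]\times[0,\infty))$. Write $F(r,u)=\int_0^u f(r,t)\,dt$. Assume: (1) $f(r,0)=0$ and $f_r(r,u)\le 0$ for all $r\in[0,1]$ and $u>0$; (2) for some $c_0>0$, $-f(r,s)<c_0 s^{p-1}$ for small $s>0$ and $r$ near $1$; (3) $F_r(r,u)\le 0$ for all $r\in[0,1]$ and $u>0$; (4) for each $r_0\in[0,1)$, the function $u\mapsto f(r_0,u)$ is either positive for all $u>0$, or it changes sign once, from negative for small $u$, to positive; (5) $u f_u(r,u)-(p-1)f(r,u)>0$ for all $r\in[0,1]$ and $u>0$; (6) for any positive solution $v(r)$ of $$\varphi(v'(r))'+\frac{n-1}{r}\varphi(v'(r))+f(r,v(r))=0,\quad 0<r<1,\qquad v'(0)=v(1)=0, \tag{P}$$ the function $$\alpha(r)=\frac{p f(r,v(r))+r f_r(r,v(r))}{v(r)f_u(r,v(r))-(p-1)f(r,v(r))}$$ is a non-increasing function of $r$ for $r\in(0,1)$. Let $u(r)$ be a positive solution of (P), and let $r_2\in(0,1]$ be the number such that $f(r,u(r))>0$ on $[0,r_2)$ and, in case $r_2<1$, $f(r,u(r))<0$ on $(r_2,1)$. In the case $p<n$, assume additionally the following two conditions: (7) $u(r)f(r,u(r))-pF(r,u(r))>0$ for $r\in(0,r_2)$; (8) the function $I(r)=npF(r,u(r))-(n-p)u(r)f(r,u(r))+pr F_r(r,u(r))$ satisfies any one of the following three conditions: (i) $I(r)>0$ on $(0,r_2)$; (ii)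 $I(r)<0$ on $(0,1)$; (iii) $I(r)>0$ on $(0,r_0)$ and $I(r)<0$ on $(r_0,1)$, for some $r_0\in(0,1)$. Then $u(r)$ is a non-degenerate solution of (P).
   Context: Here $\varphi(t)=t|t|^{p-2}$, $\varphi'(t)=(p-1)|t|^{p-2}$, and subscripts denote partial derivatives. Solutions $u$ of (P) are understood in the classical sense: $u\in C^1[0,1]$ and $\varphi(u')\in C^1(0,1]$; a solution is positive if $u(r)>0$ for $r\in[0,1)$. Under assumptions (1) and (5), a number $r_2$ as described exists for every positive solution $u$. A solution $u$ of (P) is called non-degenerate if the corresponding linearized problem $$\bigl(\varphi'(u'(r))w'(r)\bigr)'+\frac{n-1}{r}\varphi'(u'(r))w'(r)+f_u(r,u(r))w(r)=0,\ 0<r<1,\qquad w'(0)=w(1)=0,$$ for $w=w(r)$, admits only the trivial solution $w\equiv 0$.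
   Formalization: In the linearized problem, solutions w are also required to satisfy φ'(u'(r))w'(r) → 0 as r → 0+; this follows from w'(0)=0 if p ≥ 1+1/n, while for p < 1+1/n the claim is false without it (e.g. n=1, p=3/2, f=u^q, q ≥ 1). *)

theory Defs
  imports "HOL-Analysis.Analysis"
begin

definition C1_on :: "'a::real_normed_vector set \<Rightarrow> ('a \<Rightarrow> 'b::real_normed_vector) \<Rightarrow> bool" where
  "C1_on S g \<longleftrightarrow>
     (\<exists>g'. (\<forall>x\<in>S. (g has_derivative blinfun_apply (g' x)) (at x within S)) \<and> continuous_on S g')"

text \<open>One-sided at the end points of an interval S that belong to S.\<close>

definition D :: "real set \<Rightarrow> (real \<Rightarrow> real) \<Rightarrow> real \<Rightarrow> real" where
  "D S g x = vector_derivative g (at x within S)"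

text \<open>The partial derivatives of a function on [0,1] x [0,\<infinity>); f is curried, first argument r.\<close>

definition part_r :: "(real \<Rightarrow> real \<Rightarrow> real) \<Rightarrow> real \<Rightarrow> real \<Rightarrow> real" where
  "part_r f r u = D {0..1} (\<lambda>s. f s u) r"

definition part_u :: "(real \<Rightarrow> real \<Rightarrow> real) \<Rightarrow> real \<Rightarrow> real \<Rightarrow> real" where
  "part_u f r u = D {0..} (f r) u"

definition primitive :: "(real \<Rightarrow> real \<Rightarrow> real) \<Rightarrow> real \<Rightarrow> real \<Rightarrow> real" where
  "primitive f r u = integral {0..u} (f r)"

definition phi :: "real \<Rightarrow> real \<Rightarrow> real" where
  "phi p t = t * \<bar>t\<bar> powr (p - 2)"

text \<open>
  In the library 0 powr 0 = 0, so p = 2, where the derivative of phi is constantly 1, is treated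
  separately. For p < 2 the value at t = 0 is mathematically infinite and here a dummy 0.
\<close>

definition dphi :: "real \<Rightarrow> real \<Rightarrow> real" where
  "dphi p t = (p - 1) * (if p = 2 then 1 else \<bar>t\<bar> powr (p - 2))"

definition solution_P :: "real \<Rightarrow> nat \<Rightarrow> (real \<Rightarrow> real \<Rightarrow> real) \<Rightarrow> (real \<Rightarrow> real) \<Rightarrow> bool" where
  "solution_P p n f u \<longleftrightarrow>
     C1_on {0..1} u \<and>
     C1_on {0<..1} (\<lambda>r. phi p (D {0..1} u r)) \<and>
     (\<forall>r\<in>{0<..<1}.
        D {0<..1} (\<lambda>s. phi p (D {0..1} u s)) r
        + (real n - 1) / r * phi p (D {0..1} u r) + f r (u r) = 0) \<and>
     D {0..1} u 0 = 0 \<and> u 1 = 0"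

definition positive_solution_P ::
    "real \<Rightarrow> nat \<Rightarrow> (real \<Rightarrow> real \<Rightarrow> real) \<Rightarrow> (real \<Rightarrow> real) \<Rightarrow> bool" where
  "positive_solution_P p n f u \<longleftrightarrow> solution_P p n f u \<and> (\<forall>r\<in>{0..<1}. u r > 0)"

text \<open>
  Classical solutions w of the problem linearized at u, with the regularity required in
  \<^const>\<open>solution_P\<close>. The last conjunct is the linearization of phi(u'(0)) = 0. Near r = 0, phi'(u')
  behaves like a multiple of r powr ((p - 2)/(p - 1)) (when f(0,u(0)) > 0). If p \<ge> 1 + 1/n, the
  conjunct follows from w'(0) = 0 and the equation. If p < 1 + 1/n, all solutions of the linear
  equation, also those with r^(n-1) phi'(u') w' \<rightarrow> L \<noteq> 0, satisfy w'(0) = 0, and the condition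
  at the origin has to be read in terms of the flux phi'(u') w'; otherwise every positive solution
  would be degenerate.
\<close>

definition linearized_solution ::
    "real \<Rightarrow> nat \<Rightarrow> (real \<Rightarrow> real \<Rightarrow> real) \<Rightarrow> (real \<Rightarrow> real) \<Rightarrow> (real \<Rightarrow> real) \<Rightarrow> bool" where
  "linearized_solution p n f u w \<longleftrightarrow>
     C1_on {0..1} w \<and>
     C1_on {0<..1} (\<lambda>r. dphi p (D {0..1} u r) * D {0..1} w r) \<and>
     (\<forall>r\<in>{0<..<1}.
        D {0<..1} (\<lambda>s. dphi p (D {0..1} u s) * D {0..1} w s) r
        + (real n - 1) / r * (dphi p (D {0..1} u r) * D {0..1} w r)
        + part_u f r (u r) * w r = 0) \<and>
     D {0..1} w 0 = 0 \<and> w 1 = 0 \<and>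
     ((\<lambda>r. dphi p (D {0..1} u r) * D {0..1} w r) \<longlongrightarrow> 0) (at_right 0)"

definition non_degenerate ::
    "real \<Rightarrow> nat \<Rightarrow> (real \<Rightarrow> real \<Rightarrow> real) \<Rightarrow> (real \<Rightarrow> real) \<Rightarrow> bool" where
  "non_degenerate p n f u \<longleftrightarrow>
     solution_P p n f u \<and> (\<forall>w. linearized_solution p n f u w \<longrightarrow> (\<forall>r\<in>{0..1}. w r = 0))"

definition alpha :: "real \<Rightarrow> (real \<Rightarrow> real \<Rightarrow> real) \<Rightarrow> (real \<Rightarrow> real) \<Rightarrow> real \<Rightarrow> real" where
  "alpha p f v r =
     (p * f r (v r) + r * part_r f r (v r)) / (v r * part_u f r (v r) - (p - 1) * f r (v r))"

definition I_fun :: "real \<Rightarrow> nat \<Rightarrow> (real \<Rightarrow> real \<Rightarrow> real) \<Rightarrow> (real \<Rightarrow> real) \<Rightarrow> real \<Rightarrow> real" where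
  "I_fun p n f u r =
     real n * p * primitive f r (u r) - (real n - p) * u r * f r (u r)
     + p * r * part_r (primitive f) r (u r)"

end

theory Submission
  imports Defs
begin

text \<open>
Let \<open>w\<close> solve the problem linearized at \<open>u\<close>. Write \<open>U = r^(n-1) phi(u')\<close> and
\<open>V = r^(n-1) phi'(u') w'\<close> for the two fluxes. The proof is a Sturm comparison of \<open>w\<close> with the
functions \<open>\<xi> = r u' + \<gamma> u\<close>, where \<open>\<gamma>\<close> is a constant to be chosen. Differentiating the equation for
\<open>u\<close>, and using that \<open>phi\<close> is homogeneous of degree \<open>p - 1\<close>, gives

  \<open>(r^(n-1) phi'(u') \<xi>')' + r^(n-1) f_u \<xi> = r^(n-1) (u f_u - (p-1) f) (\<gamma> - \<alpha>)\<close>,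

so the Wronskian of \<open>\<xi>\<close> and \<open>w\<close> has the derivative \<open>r^(n-1) w (u f_u - (p-1) f) (\<gamma> - \<alpha>)\<close>
(\<open>G_deriv_alpha\<close>). On an interval where \<open>w > 0\<close> the Wronskian is therefore monotone as long as
\<open>\<gamma> - \<alpha>\<close> keeps its sign, while its values at zeros of \<open>w\<close> are governed by the sign of \<open>\<xi>\<close> there.
Since \<open>\<xi> = u (\<gamma> - h)\<close> with \<open>h = - r u'/u\<close>, everything depends on how \<open>h\<close> and \<open>\<alpha>\<close> compare.

The function \<open>h\<close> is strictly increasing on \<open>(0, r2)\<close>. Up to a positive factor, \<open>h'\<close> is \<open>-P\<close>, where
\<open>P\<close> is the Wronskian of \<open>r u'\<close> and \<open>u\<close>. If \<open>p \<ge> n\<close>, then \<open>P < 0\<close> follows at once from \<open>u' < 0\<close> and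
\<open>f > 0\<close>; if \<open>p < n\<close>, then \<open>P\<close> differs from minus the Pohozaev function, whose derivative is
\<open>r^(n-1) I\<close>, by a negative term (\<open>P_neg_pohozaev\<close>).

Now let \<open>w\<close> vanish at some \<open>t\<close> in \<open>(0,1)\<close>. If \<open>t < r2\<close> and \<open>h t < \<alpha> t\<close>, then, because \<open>h\<close> increases
and \<open>\<alpha>\<close> does not, \<open>h < \<alpha>\<close> to the left of \<open>t\<close>, and the choice \<open>\<gamma> = h t\<close> excludes an interval with right end
point \<open>t\<close> on which \<open>w\<close> has one sign (\<open>flux_ge_before_crossing\<close>). If \<open>h t \<ge> \<alpha> t\<close>, the same choice excludes
such an interval to the right (\<open>flux_le_after_crossing\<close>). If \<open>t \<ge> r2\<close>, then \<open>\<alpha> < 0\<close> to the right of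
\<open>t\<close>, and \<open>\<gamma> = 0\<close> does it (\<open>flux_le_beyond_r2\<close>). Hence \<open>w\<close> and \<open>V\<close> vanish together at \<open>t\<close>, and
\<open>w = 0\<close> by uniqueness for the linear system of \<open>w\<close> and \<open>V\<close>.

So a nontrivial \<open>w\<close> has one sign on \<open>(0,1)\<close>. But then the Wronskian of \<open>u\<close> and \<open>w\<close>, with the derivative
\<open>r^(n-1) w (u f_u - (p-1) f)\<close>, would be strictly monotone, although it vanishes at both \<open>0\<close> and \<open>1\<close>
(\<open>not_positive\<close>).

All of this is phrased in terms of the fluxes rather than second derivatives: \<open>phi'(u')\<close> may
vanish or blow up at \<open>r = 0\<close>, and the fluxes stay continuous there.
\<close>

section \<open>Real functions of one variable\<close>

text \<open>
The energy \<open>x^2 + z^2\<close> grows at most exponentially in either direction, so it cannot leave 0. The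
differential equations are required in the open interval only, so that the point \<open>t\<close> may be an
end point.
\<close>

lemma linear_system_unique:
  fixes x z A B :: "real \<Rightarrow> real"
  assumes cont: "continuous_on {a..b} x" "continuous_on {a..b} z"
    and x': "\<And>r. r \<in> {a<..<b} \<Longrightarrow> (x has_real_derivative A r * z r) (at r)"
    and z': "\<And>r. r \<in> {a<..<b} \<Longrightarrow> (z has_real_derivative B r * x r) (at r)"
    and K: "\<And>r. r \<in> {a<..<b} \<Longrightarrow> \<bar>A r\<bar> + \<bar>B r\<bar> \<le> K"
    and t: "t \<in> {a..b}" "x t = 0" "z t = 0" and r: "r \<in> {a..b}"
  shows "x r = 0"
proof -
  define e where "e = (\<lambda>r. (x r)\<^sup>2 + (z r)\<^sup>2)"
  have e': "(e has_real_derivative (A r + B r) * (2 * (x r * z r))) (at r)" if "r \<in> {a<..<b}" for r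
    unfolding e_def by (rule derivative_eq_intros x'[OF that] z'[OF that] refl)+ (simp add: algebra_simps)
  have bound: "\<bar>(A r + B r) * (2 * (x r * z r))\<bar> \<le> K * e r" if "r \<in> {a<..<b}" for r
  proof -
    have "\<bar>A r + B r\<bar> \<le> K" using K[OF that] by linarith
    moreover have "\<bar>2 * (x r * z r)\<bar> \<le> e r"
      using sum_squares_bound[of "x r" "z r"] sum_squares_bound[of "x r" "- z r"]
      unfolding e_def by (auto simp: abs_le_iff)
    ultimately have "\<bar>A r + B r\<bar> * \<bar>2 * (x r * z r)\<bar> \<le> K * e r"
      by (intro mult_mono) auto
    then show ?thesis by (simp add: abs_mult)
  qed
  have e_cont: "continuous_on {a..b} e"
    unfolding e_def by (intro continuous_intros cont)
  have "e r \<le> 0"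
  proof (cases "t \<le> r")
    case True
    have "exp (- K * r) * e r \<le> exp (- K * t) * e t"
    proof (rule DERIV_nonpos_imp_decreasing_open[where f = "\<lambda>r. exp (- K * r) * e r", OF True])
      show "continuous_on {t..r} (\<lambda>r. exp (- K * r) * e r)"
        using t r by (intro continuous_intros continuous_on_subset[OF e_cont]) auto
      fix s assume s: "t < s" "s < r"
      then have s': "s \<in> {a<..<b}" using t r by auto
      have "((\<lambda>r. exp (- K * r) * e r) has_real_derivative
              exp (- K * s) * ((A s + B s) * (2 * (x s * z s)) - K * e s)) (at s)"
        by (rule derivative_eq_intros e'[OF s'] refl)+ (simp add: algebra_simps)
      then show "\<exists>y. ((\<lambda>r. exp (- K * r) * e r) has_real_derivative y) (at s) \<and> y \<le> 0"
        using bound[OF s'] by (intro exI conjI) (auto simp: mult_le_0_iff)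
    qed
    then show ?thesis using t by (simp add: e_def mult_le_0_iff)
  next
    case False
    have "exp (K * r) * e r \<le> exp (K * t) * e t"
    proof (rule DERIV_nonneg_imp_increasing_open[where f = "\<lambda>r. exp (K * r) * e r"])
      show "r \<le> t" using False by simp
      show "continuous_on {r..t} (\<lambda>r. exp (K * r) * e r)"
        using t r by (intro continuous_intros continuous_on_subset[OF e_cont]) auto
      fix s assume s: "r < s" "s < t"
      then have s': "s \<in> {a<..<b}" using t r by auto
      have "((\<lambda>r. exp (K * r) * e r) has_real_derivative
              exp (K * s) * ((A s + B s) * (2 * (x s * z s)) + K * e s)) (at s)"
        by (rule derivative_eq_intros e'[OF s'] refl)+ (simp add: algebra_simps)
      then show "\<exists>y. ((\<lambda>r. exp (K * r) * e r) has_real_derivative y) (at s) \<and> 0 \<le> y"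
        using bound[OF s'] by (intro exI conjI) auto
    qed
    then show ?thesis using t by (simp add: e_def mult_le_0_iff)
  qed
  then show ?thesis
    unfolding e_def by (metis sum_power2_le_zero_iff)
qed

lemma first_nonpositive_zero:
  fixes w :: "real \<Rightarrow> real"
  assumes cont: "continuous_on {b..c} w" and pos: "w b > 0" and c: "b \<le> c" "w c \<le> 0"
  obtains \<tau> where "\<tau> \<in> {b<..c}" "w \<tau> = 0" "\<And>r. r \<in> {b..<\<tau>} \<Longrightarrow> w r > 0"
proof -
  define S where "S = {b..c} \<inter> w -` {..0}"
  have "closed S" unfolding S_def by (intro continuous_closed_preimage[OF cont]) auto
  moreover have "bounded S" unfolding S_def by (rule bounded_subset[of "{b..c}"]) auto
  ultimately have "compact S" by (simp add: compact_eq_bounded_closed)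
  moreover have "S \<noteq> {}" using c by (auto simp: S_def)
  ultimately have "\<exists>\<tau>\<in>S. \<forall>s\<in>S. \<tau> \<le> s" by (rule compact_attains_inf)
  then obtain \<tau> where \<tau>: "\<tau> \<in> S" "\<And>s. s \<in> S \<Longrightarrow> \<tau> \<le> s" by blast
  have before: "w r > 0" if "r \<in> {b..<\<tau>}" for r
    using \<tau>(2)[of r] \<tau>(1) that by (force simp: S_def)
  have "b \<le> \<tau>" "\<tau> \<le> c" "w \<tau> \<le> 0" using \<tau>(1) by (auto simp: S_def)
  then obtain z where z: "b \<le> z" "z \<le> \<tau>" "w z = 0"
    using IVT2'[of w \<tau> 0 b] pos continuous_on_subset[OF cont, of "{b..\<tau>}"] by auto
  then have "z = \<tau>" using before[of z] by force
  show thesis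
  proof (rule that)
    show "\<tau> \<in> {b<..c}" "w \<tau> = 0"
      using z pos \<open>z = \<tau>\<close> \<open>\<tau> \<le> c\<close> by (auto simp: order_less_le)
  qed (fact before)
qed

section \<open>The nonlinearity of the p-Laplacian\<close>

lemma dphi_mult: "p > 1 \<Longrightarrow> dphi p t * t = (p - 1) * phi p t"
  by (cases "t = 0") (auto simp: dphi_def phi_def)

lemma dphi_pos: "p > 1 \<Longrightarrow> t \<noteq> 0 \<Longrightarrow> dphi p t > 0"
  by (auto simp: dphi_def)

lemma phi_neg_iff: "phi p t < 0 \<longleftrightarrow> t < 0"
  by (cases "t = 0") (auto simp: phi_def mult_less_0_iff)

lemma phi_eq_powr: "t < 0 \<Longrightarrow> phi p t = - ((- t) powr (p - 1))"
  using powr_mult_base[of "- t" "p - 2"] by (auto simp: phi_def)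

lemma continuous_on_phi:
  assumes p: "p > 1"
  shows "continuous_on UNIV (phi p)"
proof -
  have "phi p = (\<lambda>t. (max t 0) powr (p - 1) - (max (- t) 0) powr (p - 1))"
  proof
    fix t show "phi p t = (max t 0) powr (p - 1) - (max (- t) 0) powr (p - 1)"
      using powr_mult_base[of t "p - 2"] powr_mult_base[of "- t" "p - 2"]
      by (cases t "0::real" rule: linorder_cases) (auto simp: phi_def)
  qed
  moreover have "continuous_on UNIV (\<lambda>t. (max t 0) powr (p - 1) - (max (- t) 0) powr (p - 1))"
    using p by (intro continuous_intros continuous_on_powr') auto
  ultimately show ?thesis by simp
qed

text \<open>
On the negative half line \<open>phi\<close> has the differentiable inverse \<open>s \<mapsto> - (- s) powr (1 / (p - 1))\<close>. Hence
\<open>u'\<close> is differentiable wherever it is negative, although only \<open>phi(u')\<close> is assumed to be so.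
\<close>

lemma has_derivative_of_phi:
  fixes y :: "real \<Rightarrow> real"
  assumes p: "p > 1" and neg: "y r < 0" and cont: "isCont y r"
    and der: "((\<lambda>s. phi p (y s)) has_real_derivative d) (at r)"
  shows "(y has_real_derivative d / dphi p (y r)) (at r)"
proof -
  define k where "k = 1 / (p - 1)"
  have k: "(p - 1) * k = 1" "(p - 1) * (k - 1) = 2 - p"
    using p by (auto simp: k_def field_simps)
  have "((\<lambda>s. - ((- phi p (y s)) powr k)) has_real_derivative
          - (k * (- phi p (y r)) powr (k - 1) * (- d))) (at r)"
    using neg phi_neg_iff[of p "y r"]
    by (auto intro!: derivative_eq_intros der)
  moreover have "- (k * (- phi p (y r)) powr (k - 1) * (- d)) = d / dphi p (y r)"
  proof -
    have "(- phi p (y r)) powr (k - 1) = (- y r) powr (2 - p)"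
      using neg k by (simp add: phi_eq_powr powr_powr)
    also have "\<dots> = inverse ((- y r) powr (p - 2))"
      by (metis minus_diff_eq powr_minus)
    finally show ?thesis using neg p
      by (auto simp: dphi_def k_def divide_simps)
  qed
  moreover have "\<forall>\<^sub>F s in nhds r. - ((- phi p (y s)) powr k) = y s"
  proof -
    have "\<forall>\<^sub>F s in nhds r. y s < 0"
      using cont neg order_tendstoD(2)[of y "y r" "nhds r" 0]
      by (simp add: isCont_def tendsto_at_iff_tendsto_nhds)
    then show ?thesis
      by eventually_elim (use k in \<open>simp add: phi_eq_powr powr_powr\<close>)
  qed
  ultimately show ?thesis
    using DERIV_cong_ev[OF refl _ refl, of "\<lambda>s. - ((- phi p (y s)) powr k)" y r] by simp
qed

section \<open>Positive radial solutions\<close>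

text \<open>
The functions \<open>g\<close>, \<open>gu\<close>, \<open>gr\<close> stand for \<open>f\<close>, \<open>f_u\<close>, \<open>f_r\<close> evaluated along the solution, \<open>r \<mapsto> (r, u r)\<close>,
and \<open>y\<close> for \<open>u'\<close>. This reduces the argument to functions of one variable.
\<close>

locale radial_solution =
  fixes p :: real and n :: nat and u y g gu gr :: "real \<Rightarrow> real" and r2 :: real
  assumes n: "n \<ge> 1" and p: "p > 1"
    and u_deriv: "\<And>r. r \<in> {0..1} \<Longrightarrow> (u has_real_derivative y r) (at r within {0..1})"
    and y_cont: "continuous_on {0..1} y"
    and flux_eq: "\<And>r. r \<in> {0<..<1} \<Longrightarrow> ((\<lambda>r. phi p (y r)) has_real_derivative
                    (- (real n - 1) / r * phi p (y r) - g r)) (at r)"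
    and g_deriv: "\<And>r. r \<in> {0<..<1} \<Longrightarrow> (g has_real_derivative gr r + gu r * y r) (at r)"
    and g_cont: "continuous_on {0..1} g"
    and gu_cont: "continuous_on {0..1} gu"
    and y_0: "y 0 = 0" and u_1: "u 1 = 0" and u_pos: "\<And>r. r \<in> {0..<1} \<Longrightarrow> u r > 0"
    and r2: "r2 \<in> {0<..1}"
    and g_pos: "\<And>r. r \<in> {0..<r2} \<Longrightarrow> g r > 0" and g_neg: "\<And>r. r \<in> {r2<..<1} \<Longrightarrow> g r < 0"
begin

definition U :: "real \<Rightarrow> real" where "U r = r ^ (n - 1) * phi p (y r)"

lemma pow_n: "r ^ n = r * r ^ (n - 1)" for r :: real
  using n by (cases n) auto

lemma pow_deriv: "r > 0 \<Longrightarrow>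
  ((\<lambda>r. r ^ (n - 1)) has_real_derivative (real n - 1) / r * r ^ (n - 1)) (at r)"
proof (cases "n - 1")
  case (Suc m)
  then have "real n - 1 = real (Suc m)" by simp
  moreover assume "r > 0"
  ultimately show ?thesis
    using DERIV_pow[of "Suc m" r UNIV] Suc by simp
qed (use n in auto)

lemma pow_n_deriv: "((\<lambda>r. r ^ n) has_real_derivative real n * r ^ (n - 1)) (at r)"
  using n by (auto intro!: derivative_eq_intros)

lemma u_deriv_at: "r \<in> {0<..<1} \<Longrightarrow> (u has_real_derivative y r) (at r)"
  using u_deriv[of r] at_within_Icc_at[of 0 r 1] by auto

lemma u_cont: "continuous_on {0..1} u"
  using u_deriv by (meson DERIV_continuous continuous_on_eq_continuous_within)

lemma U_deriv: "r \<in> {0<..<1} \<Longrightarrow> (U has_real_derivative - (r ^ (n - 1) * g r)) (at r)"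
  unfolding U_def
proof -
  assume r: "r \<in> {0<..<1}"
  then have "r > 0" by simp
  from DERIV_mult[OF pow_deriv[OF this] flux_eq[OF r]]
  show "((\<lambda>r. r ^ (n - 1) * phi p (y r)) has_real_derivative - (r ^ (n - 1) * g r)) (at r)"
    by (rule DERIV_cong) (use r in \<open>simp add: field_simps\<close>)
qed

lemma U_cont: "continuous_on {0..1} U"
  unfolding U_def
  by (intro continuous_intros continuous_on_compose2[OF continuous_on_phi[OF p] y_cont]) auto

lemma U_0: "U 0 = 0"
  by (simp add: U_def y_0 phi_def)

lemma y_1_le: "y 1 \<le> 0"
proof (rule ccontr)
  assume "\<not> y 1 \<le> 0"
  then have "y 1 > 0" by simp
  then obtain d where d: "d > 0" "\<And>h. h > 0 \<Longrightarrow> 1 - h \<in> {0..1} \<Longrightarrow> h < d \<Longrightarrow> u (1 - h) < u 1"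
    using has_real_derivative_pos_inc_left[of u "y 1" 1 "{0..1}"] u_deriv[of 1] by auto
  define h where "h = min (d / 2) 1"
  have h: "0 < h" "h \<le> 1" "h < d" using d(1) by (auto simp: h_def)
  then have "u (1 - h) < u 1" by (intro d) auto
  then show False using u_1 u_pos[of "1 - h"] h by auto
qed

lemma U_1_le: "U 1 \<le> 0"
  using y_1_le phi_neg_iff[of p "y 1"] by (cases "y 1 = 0") (auto simp: U_def phi_def)

text \<open>
The flux \<open>U\<close> starts from 0, decreases while \<open>g > 0\<close> and increases while \<open>g < 0\<close>, and ends at a value
\<open>\<le> 0\<close>; so it is negative in between.
\<close>

lemma U_neg: assumes r: "r \<in> {0<..<1}" shows "U r < 0"
proof (cases "r \<le> r2")
  case True
  have "U r < U 0"
  proof (rule DERIV_neg_imp_decreasing_open[where f = U])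
    show "continuous_on {0..r} U" using r by (intro continuous_on_subset[OF U_cont]) auto
    fix s assume "0 < s" "s < r"
    then show "\<exists>d. (U has_real_derivative d) (at s) \<and> d < 0"
      using U_deriv[of s] g_pos[of s] r True by (intro exI conjI) auto
  qed (use r in auto)
  then show ?thesis by (simp add: U_0)
next
  case False
  have "U r < U 1"
  proof (rule DERIV_pos_imp_increasing_open[where f = U])
    show "continuous_on {r..1} U" using r by (intro continuous_on_subset[OF U_cont]) auto
    fix s assume "r < s" "s < 1"
    then show "\<exists>d. (U has_real_derivative d) (at s) \<and> 0 < d"
      using U_deriv[of s] g_neg[of s] r False by (intro exI[of _ "- (s ^ (n - 1) * g s)"] conjI) (auto simp: mult_pos_neg)
  qed (use r in auto)
  then show ?thesis using U_1_le by simp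
qed

lemma y_neg: "r \<in> {0<..<1} \<Longrightarrow> y r < 0"
  using U_neg[of r] by (auto simp: U_def mult_less_0_iff phi_neg_iff)

lemma y_1_neg: assumes "r2 = 1" shows "y 1 < 0"
proof -
  have "U 1 < U 0"
  proof (rule DERIV_neg_imp_decreasing_open[OF _ _ U_cont])
    fix s :: real assume "0 < s" "s < 1"
    then show "\<exists>d. (U has_real_derivative d) (at s) \<and> d < 0"
      using U_deriv[of s] g_pos[of s] assms by (intro exI conjI) auto
  qed auto
  then show ?thesis by (simp add: U_0) (simp add: U_def phi_neg_iff)
qed

abbreviation a :: "real \<Rightarrow> real" where "a r \<equiv> dphi p (y r)"

lemma a_pos: "r \<in> {0<..<1} \<Longrightarrow> a r > 0"
  using y_neg[of r] dphi_pos[OF p, of "y r"] by simp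

lemma a_y: "r ^ (n - 1) * a r * y r = (p - 1) * U r"
  using dphi_mult[OF p, of "y r"] by (simp add: U_def mult_ac)

text \<open>
This is \<open>u''\<close>: the equation for \<open>u\<close>, solved by means of \<open>(phi(u'))' = phi'(u') u''\<close>.
\<close>

definition y' :: "real \<Rightarrow> real" where
  "y' r = (- (real n - 1) / r * phi p (y r) - g r) / a r"

lemma y_deriv: assumes r: "r \<in> {0<..<1}"
  shows "(y has_real_derivative y' r) (at r)"
  unfolding y'_def
proof (rule has_derivative_of_phi[OF p y_neg[OF r] _ flux_eq[OF r]])
  show "isCont y r" by (rule continuous_on_interior[OF y_cont]) (use r in simp)
qed

text \<open>
\<open>Z\<close> is the flux \<open>r^(n-1) phi'(u') z'\<close> of \<open>z = r u'\<close>. The equation for \<open>u\<close> eliminates \<open>u''\<close> from it,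
which makes it continuous up to the end points.
\<close>

definition Z :: "real \<Rightarrow> real" where "Z r = (p - real n) * U r - r ^ n * g r"

lemma Z_eq: assumes r: "r \<in> {0<..<1}" shows "r ^ (n - 1) * a r * (y r + r * y' r) = Z r"
proof -
  have "a r * (r * y' r) = - (real n - 1) * phi p (y r) - r * g r"
  proof -
    have "a r * y' r = - (real n - 1) / r * phi p (y r) - g r"
      using a_pos[OF r] by (simp add: y'_def)
    then have "r * (a r * y' r) = r * (- (real n - 1) / r * phi p (y r) - g r)" by simp
    also have "\<dots> = - (real n - 1) * phi p (y r) - r * g r"
      using r by (simp add: right_diff_distrib)
    finally show ?thesis by (simp only: mult.left_commute)
  qed
  moreover have "a r * y r = (p - 1) * phi p (y r)" using dphi_mult[OF p] by simp
  ultimately have "a r * (y r + r * y' r) = (p - real n) * phi p (y r) - r * g r"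
    by (simp add: algebra_simps)
  then have "r ^ (n - 1) * (a r * (y r + r * y' r)) = r ^ (n - 1) * ((p - real n) * phi p (y r) - r * g r)"
    by simp
  then show ?thesis by (simp add: Z_def U_def pow_n algebra_simps)
qed

lemma Z_deriv: assumes r: "r \<in> {0<..<1}"
  shows "(Z has_real_derivative - (r ^ (n - 1) * (p * g r + r * gr r + gu r * (r * y r)))) (at r)"
  unfolding Z_def
  by (rule DERIV_cong[OF DERIV_diff[OF DERIV_cmult[OF U_deriv[OF r]]
        DERIV_mult[OF pow_n_deriv g_deriv[OF r]]]])
     (simp add: pow_n algebra_simps)

lemma Z_cont: "continuous_on {0..1} Z"
  unfolding Z_def by (intro continuous_intros U_cont g_cont)

lemma Z_0: "Z 0 = 0"
  using n by (simp add: Z_def U_0)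

section \<open>The linearized problem as a first-order system\<close>

text \<open>
Solutions of the linearized problem together with their flux \<open>V = r^(n-1) phi'(u') w'\<close>. The condition
at the origin is \<open>V 0 = 0\<close>.
\<close>

definition lin_pair :: "(real \<Rightarrow> real) \<Rightarrow> (real \<Rightarrow> real) \<Rightarrow> bool" where
  "lin_pair w V \<longleftrightarrow> continuous_on {0..1} w \<and> continuous_on {0..1} V \<and>
     (\<forall>r\<in>{0<..<1}. (w has_real_derivative V r / (r ^ (n - 1) * a r)) (at r) \<and>
                    (V has_real_derivative - (r ^ (n - 1) * gu r * w r)) (at r)) \<and>
     w 1 = 0 \<and> V 0 = 0"

lemma lin_pairD:
  assumes "lin_pair w V"
  shows "continuous_on {0..1} w" "continuous_on {0..1} V" "w 1 = 0" "V 0 = 0"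
    "\<And>r. r \<in> {0<..<1} \<Longrightarrow> (w has_real_derivative V r / (r ^ (n - 1) * a r)) (at r)"
    "\<And>r. r \<in> {0<..<1} \<Longrightarrow> (V has_real_derivative - (r ^ (n - 1) * gu r * w r)) (at r)"
  using assms unfolding lin_pair_def by auto

lemma lin_pair_minus: "lin_pair w V \<Longrightarrow> lin_pair (\<lambda>r. - w r) (\<lambda>r. - V r)"
  proof -
  assume wV: "lin_pair w V"
  have "((\<lambda>r. - w r) has_real_derivative - V r / (r ^ (n - 1) * a r)) (at r)"
    "((\<lambda>r. - V r) has_real_derivative - (r ^ (n - 1) * gu r * - w r)) (at r)"
    if "r \<in> {0<..<1}" for r
    using DERIV_minus[OF lin_pairD(5)[OF wV that]] DERIV_minus[OF lin_pairD(6)[OF wV that]]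
    by auto
  then show ?thesis
    using lin_pairD(1-4)[OF wV] unfolding lin_pair_def by (simp add: continuous_on_minus)
qed

lemma weight_pos: "r \<in> {0<..<1} \<Longrightarrow> r ^ (n - 1) * a r > 0"
  using a_pos by simp

text \<open>
The system for \<open>w\<close> and \<open>V\<close> is regular where \<open>u' < 0\<close>. This covers compact subintervals of \<open>(0,1)\<close>, and
also the end point 1 provided that \<open>u'(1) < 0\<close>.
\<close>

lemma lin_pair_unique:
  assumes wV: "lin_pair w V" and ab: "0 < b" "c \<le> 1" "y c < 0 \<or> c < 1"
    and t: "t \<in> {b..c}" "w t = 0" "V t = 0" and r: "r \<in> {b..c}"
  shows "w r = 0"
proof -
  define A where "A = (\<lambda>r. 1 / (r ^ (n - 1) * a r))"
  define B where "B = (\<lambda>r. - (r ^ (n - 1) * gu r))"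
  have y: "y s < 0" if "s \<in> {b..c}" for s
    using that ab y_neg[of s] by (cases "s = 1") auto
  have sub: "{b..c} \<subseteq> {0..1}" using ab by auto
  have "continuous_on {b..c} (\<lambda>r. (p - 1) * \<bar>y r\<bar> powr (p - 2))"
    using y by (intro continuous_intros continuous_on_subset[OF y_cont sub]) force
  then have "continuous_on {b..c} a"
    using y by (rule_tac continuous_on_eq) (force simp: dphi_def)+
  moreover have "s ^ (n - 1) * a s \<noteq> 0" if "s \<in> {b..c}" for s
    using y[OF that] that ab dphi_pos[OF p, of "y s"] by auto
  ultimately have "continuous_on {b..c} (\<lambda>r. \<bar>A r\<bar> + \<bar>B r\<bar>)"
    unfolding A_def B_def
    by (intro continuous_intros continuous_on_subset[OF gu_cont sub]) auto
  then have "bdd_above ((\<lambda>r. \<bar>A r\<bar> + \<bar>B r\<bar>) ` {b..c})"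
    by (intro bounded_imp_bdd_above compact_imp_bounded compact_continuous_image) auto
  then obtain K where K: "\<And>s. s \<in> {b..c} \<Longrightarrow> \<bar>A s\<bar> + \<bar>B s\<bar> \<le> K"
    unfolding bdd_above_def by blast
  show ?thesis
  proof (rule linear_system_unique[where x = w and z = V and A = A and B = B and a = b and b = c and t = t and K = K])
    show "continuous_on {b..c} w" "continuous_on {b..c} V"
      using lin_pairD(1,2)[OF wV] sub by (auto intro: continuous_on_subset)
  next
    fix s assume "s \<in> {b<..<c}"
    then have s: "s \<in> {0<..<1}" using ab by auto
    show "(w has_real_derivative A s * V s) (at s)"
      using lin_pairD(5)[OF wV s] by (simp add: A_def)
    show "(V has_real_derivative B s * w s) (at s)"
      using lin_pairD(6)[OF wV s] by (simp add: B_def)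
  qed (use t r K in auto)
qed

text \<open>
The sign of \<open>V\<close> is compared with that of \<open>w'\<close> near \<open>\<tau>\<close> and not at \<open>\<tau>\<close>, because \<open>\<tau> = 1\<close> is allowed,
where the coefficient \<open>phi'(u')\<close> may vanish.
\<close>

lemma flux_sign_right_end:
  assumes wV: "lin_pair w V" and st: "0 \<le> \<sigma>" "\<sigma> < \<tau>" "\<tau> \<le> 1"
    and pos: "\<And>r. r \<in> {\<sigma><..<\<tau>} \<Longrightarrow> w r > 0" and 0: "w \<tau> = 0"
  shows "V \<tau> \<le> 0"
proof (rule ccontr)
  assume "\<not> V \<tau> \<le> 0"
  then have "V \<tau> > 0" by simp
  moreover have "(V \<longlongrightarrow> V \<tau>) (at \<tau> within {0..1})"
    using lin_pairD(2)[OF wV] st by (auto simp: continuous_on_def)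
  ultimately have "\<forall>\<^sub>F s in at \<tau> within {0..1}. V s > 0" by (simp add: order_tendstoD)
  then obtain d where d: "d > 0" "\<And>s. s \<in> {0..1} \<Longrightarrow> s \<noteq> \<tau> \<Longrightarrow> dist s \<tau> < d \<Longrightarrow> V s > 0"
    unfolding eventually_at by blast
  define s where "s = max ((\<sigma> + \<tau>) / 2) (\<tau> - d / 2)"
  have s: "\<sigma> < s" "s < \<tau>" "\<tau> - d < s" using st d by (auto simp: s_def max_def field_simps)
  have "w s < w \<tau>"
  proof (rule DERIV_pos_imp_increasing_open[where f = w])
    show "continuous_on {s..\<tau>} w"
      using lin_pairD(1)[OF wV] s st by (auto intro: continuous_on_subset)
    fix x assume x: "s < x" "x < \<tau>"
    then have x': "x \<in> {0<..<1}" using s st by auto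
    have "V x > 0" using d(2)[of x] x s st by (auto simp: dist_real_def)
    then show "\<exists>y. (w has_real_derivative y) (at x) \<and> 0 < y"
      using lin_pairD(5)[OF wV x'] weight_pos[OF x'] by (intro exI conjI) (assumption, simp)
  qed (use s in auto)
  then show False using pos[of s] s 0 by auto
qed

lemma flux_sign_left_end:
  assumes wV: "lin_pair w V" and st: "0 < \<sigma>" "\<sigma> < \<tau>" "\<tau> \<le> 1"
    and pos: "\<And>r. r \<in> {\<sigma><..<\<tau>} \<Longrightarrow> w r > 0" and 0: "w \<sigma> = 0"
  shows "V \<sigma> \<ge> 0"
proof (rule ccontr)
  assume neg: "\<not> V \<sigma> \<ge> 0"
  have s: "\<sigma> \<in> {0<..<1}" using st by auto
  have "V \<sigma> / (\<sigma> ^ (n - 1) * a \<sigma>) < 0" using neg weight_pos[OF s] by (simp add: divide_neg_pos)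
  then obtain d where d: "d > 0" "\<And>h. h > 0 \<Longrightarrow> h < d \<Longrightarrow> w (\<sigma> + h) < 0"
    using DERIV_neg_dec_right[OF lin_pairD(5)[OF wV s]] 0 by auto
  define m where "m = min (d / 2) ((\<tau> - \<sigma>) / 2)"
  have "m > 0" "m < d" "\<sigma> + m < \<tau>" using d st by (auto simp: m_def min_def field_simps)
  then show False using d(2)[of m] pos[of "\<sigma> + m"] by auto
qed

lemma nodal_interval_right:
  assumes wV: "lin_pair w V" and t: "t \<in> {0<..<1}" "w t = 0" "V t > 0"
  obtains \<tau> where "\<tau> \<in> {t<..1}" "w \<tau> = 0" "\<And>r. r \<in> {t<..<\<tau>} \<Longrightarrow> w r > 0"
proof -
  have "V t / (t ^ (n - 1) * a t) > 0" using t weight_pos[OF t(1)] by simp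
  then obtain d where d: "d > 0" "\<And>h. h > 0 \<Longrightarrow> h < d \<Longrightarrow> w (t + h) > 0"
    using DERIV_pos_inc_right[OF lin_pairD(5)[OF wV t(1)]] t by auto
  define m where "m = min (d / 2) ((1 - t) / 2)"
  have m: "m > 0" "m < d" "t + m < 1" using d t by (auto simp: m_def min_def field_simps)
  have c: "continuous_on {t + m..1} w"
    using lin_pairD(1)[OF wV] t m by (auto intro: continuous_on_subset)
  have "w (t + m) > 0" using d(2) m by simp
  from first_nonpositive_zero[OF c this] m lin_pairD(3)[OF wV]
  obtain \<tau> where \<tau>: "\<tau> \<in> {t + m<..1}" "w \<tau> = 0" "\<And>r. r \<in> {t + m..<\<tau>} \<Longrightarrow> w r > 0" by auto
  have pos: "w r > 0" if "r \<in> {t<..<\<tau>}" for r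
    using \<tau>(3)[of r] d(2)[of "r - t"] that m by (cases "r < t + m") auto
  show thesis
  proof (rule that)
    show "\<tau> \<in> {t<..1}" using \<tau>(1) m(1) by auto
  qed (fact \<tau>(2) pos)+
qed

lemma nodal_interval_left:
  assumes wV: "lin_pair w V" and t: "t \<in> {0<..<1}" "w t = 0" "V t < 0"
  obtains \<sigma> where "\<sigma> \<in> {0..<t}" "\<sigma> = 0 \<or> w \<sigma> = 0" "\<And>r. r \<in> {\<sigma><..<t} \<Longrightarrow> w r > 0"
proof -
  have "V t / (t ^ (n - 1) * a t) < 0" using t weight_pos[OF t(1)] by (simp add: divide_neg_pos)
  then obtain d where d: "d > 0" "\<And>h. h > 0 \<Longrightarrow> h < d \<Longrightarrow> w (t - h) > 0"
    using DERIV_neg_dec_left[OF lin_pairD(5)[OF wV t(1)]] t by auto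
  define m where "m = min (d / 2) (t / 2)"
  have m: "m > 0" "m < d" "0 < t - m" using d t by (auto simp: m_def min_def field_simps)
  have near: "w r > 0" if "r \<in> {t - m..<t}" for r
    using d(2)[of "t - r"] that m by auto
  show thesis
  proof (cases "\<exists>s\<in>{0..t - m}. w s \<le> 0")
    case False
    then have pos: "w r > 0" if "r \<in> {0<..<t}" for r
      using near[of r] that by (cases "r < t - m") (auto simp: not_le)
    show thesis
    proof (rule that)
      show "0 \<in> {0..<t}" using t by auto
    qed (auto intro: pos)
  next
    case True
    then obtain s where s: "s \<in> {0..t - m}" "w s \<le> 0" by blast
    have c: "continuous_on {- (t - m).. - s} (\<lambda>x. w (- x))"
      using t m s by (intro continuous_on_compose2[OF lin_pairD(1)[OF wV]] continuous_intros) auto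
    from first_nonpositive_zero[OF c] s near[of "t - m"] m
    obtain x where x: "x \<in> {- (t - m)<.. - s}" "w (- x) = 0"
      "\<And>r. r \<in> {- (t - m)..<x} \<Longrightarrow> w (- r) > 0" by auto
    have pos: "w r > 0" if "r \<in> {- x<..<t}" for r
      using near[of r] x(3)[of "- r"] that by (cases "r < t - m") auto
    show thesis
    proof (rule that)
      show "- x \<in> {0..<t}" using x(1) s m by auto
    qed (use x(2) pos in auto)
  qed
qed

section \<open>Comparison functions\<close>

text \<open>
\<open>G\<close> is the Wronskian \<open>r^(n-1) phi'(u') (\<xi>' w - \<xi> w')\<close> of \<open>\<xi> = r u' + \<gamma> u\<close> and \<open>w\<close>, since the flux of
\<open>\<xi>\<close> is \<open>Z + \<gamma> (p-1) U\<close>.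
\<close>

definition G :: "(real \<Rightarrow> real) \<Rightarrow> (real \<Rightarrow> real) \<Rightarrow> real \<Rightarrow> real \<Rightarrow> real" where
  "G w V \<gamma> r = w r * (Z r + \<gamma> * ((p - 1) * U r)) - (r * y r + \<gamma> * u r) * V r"

lemma G_deriv:
  assumes wV: "lin_pair w V" and r: "r \<in> {0<..<1}"
  shows "(G w V \<gamma> has_real_derivative
    r ^ (n - 1) * w r * (\<gamma> * (u r * gu r - (p - 1) * g r) - (p * g r + r * gr r))) (at r)"
proof -
  let ?c = "r ^ (n - 1) * a r"
  let ?X = "Z r + \<gamma> * ((p - 1) * U r)"
  have c: "?c \<noteq> 0" using weight_pos[OF r] by linarith
  have "?X = ?c * (y r + r * y' r) + \<gamma> * (?c * y r)"
    by (simp only: Z_eq[OF r] a_y)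
  also have "\<dots> = ?c * (y r + r * y' r + \<gamma> * y r)"
    by (simp add: algebra_simps)
  finally have X: "?X = ?c * (y r + r * y' r + \<gamma> * y r)" .
  have "v / c * (c * x) = x * v" if "c \<noteq> 0" for v c x :: real
    using that by simp
  from this[OF c] have *: "V r / ?c * ?X = (y r + r * y' r + \<gamma> * y r) * V r"
    unfolding X .
  have 1: "((\<lambda>r. r * y r + \<gamma> * u r) has_real_derivative (y r + r * y' r + \<gamma> * y r)) (at r)"
    by (rule derivative_eq_intros y_deriv[OF r] u_deriv_at[OF r] refl)+ simp
  have 2: "((\<lambda>r. Z r + \<gamma> * ((p - 1) * U r)) has_real_derivative
       - (r ^ (n - 1) * (p * g r + r * gr r + gu r * (r * y r)))
       + \<gamma> * ((p - 1) * (- (r ^ (n - 1) * g r)))) (at r)"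
    by (intro DERIV_add DERIV_cmult Z_deriv[OF r] U_deriv[OF r])
  note D = DERIV_diff[OF DERIV_mult[OF lin_pairD(5)[OF wV r] 2]
                         DERIV_mult[OF 1 lin_pairD(6)[OF wV r]]]
  show ?thesis
    unfolding G_def by (rule DERIV_cong[OF D], unfold *) (simp add: algebra_simps)
qed

lemma G_cont: assumes wV: "lin_pair w V" shows "continuous_on {0..1} (G w V \<gamma>)"
  unfolding G_def
  by (intro continuous_on_add continuous_on_diff continuous_on_mult continuous_on_const
        continuous_on_id Z_cont U_cont y_cont u_cont lin_pairD(1,2)[OF wV])

lemma G_0: "lin_pair w V \<Longrightarrow> G w V \<gamma> 0 = 0"
  using lin_pairD(4)[of w V] by (simp add: G_def Z_0 U_0)

lemma G_zero: "w r = 0 \<Longrightarrow> G w V \<gamma> r = - ((r * y r + \<gamma> * u r) * V r)"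
  by (simp add: G_def)

section \<open>Monotonicity of the logarithmic derivative\<close>

text \<open>
\<open>P\<close> is the Wronskian \<open>r^(n-1) phi'(u') (z' u - z u')\<close> of \<open>z = r u'\<close> and \<open>u\<close>.
\<close>

definition P :: "real \<Rightarrow> real" where "P r = u r * Z r - r * y r * ((p - 1) * U r)"

text \<open>
\<open>h r\<close> is the constant \<open>\<gamma>\<close> for which \<open>r u' + \<gamma> u\<close> vanishes at \<open>r\<close>.
\<close>

definition h :: "real \<Rightarrow> real" where "h r = - (r * y r) / u r"

lemma h_deriv: assumes r: "r \<in> {0<..<1}"
  shows "(h has_real_derivative - P r / (r ^ (n - 1) * a r * (u r)\<^sup>2)) (at r)"
proof -
  let ?c = "r ^ (n - 1) * a r"
  have c: "?c > 0" using weight_pos[OF r] by simp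
  have u: "u r > 0" using u_pos[of r] r by simp
  have 1: "((\<lambda>r. - (r * y r)) has_real_derivative - (y r + r * y' r)) (at r)"
    by (rule derivative_eq_intros y_deriv[OF r] refl)+ simp
  have "- P r = - (u r * (?c * (y r + r * y' r)) - r * y r * (?c * y r))"
    by (simp only: Z_eq[OF r] a_y P_def)
  also have "\<dots> = ?c * (- (y r + r * y' r) * u r + r * y r * y r)"
    by (simp add: algebra_simps)
  finally have 2: "- P r = ?c * (- (y r + r * y' r) * u r + r * y r * y r)" .
  have "c * x / (c * d\<^sup>2) = x / (d * d)" if "c > 0" for c d x :: real
    using that by (simp add: power2_eq_square)
  from this[OF c] have 3: "- P r / (?c * (u r)\<^sup>2) = (- (y r + r * y' r) * u r - - (r * y r) * y r) / (u r * u r)"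
    unfolding 2 by simp
  show ?thesis unfolding h_def 3
    by (rule DERIV_divide[OF 1 u_deriv_at[OF r]]) (use u in simp)
qed

lemma h_increasing:
  assumes "\<And>r. r \<in> {0<..<r2} \<Longrightarrow> P r < 0" and "0 < s" "s < t" "t < r2"
  shows "h s < h t"
proof (rule DERIV_pos_imp_increasing[where f = h, OF \<open>s < t\<close>])
  fix x assume x: "s \<le> x" "x \<le> t"
  then have x': "x \<in> {0<..<1}" "x \<in> {0<..<r2}" using assms r2 by auto
  have "- P x / (x ^ (n - 1) * a x * (u x)\<^sup>2) > 0"
    using assms(1)[OF x'(2)] weight_pos[OF x'(1)] u_pos[of x] x'
    by (intro divide_pos_pos mult_pos_pos[of "x ^ (n - 1) * a x"]) auto
  with h_deriv[OF x'(1)] show "\<exists>y. (h has_real_derivative y) (at x) \<and> 0 < y" by blast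
qed

lemma P_neg_large_p:
  assumes "p \<ge> real n" "r \<in> {0<..<r2}" shows "P r < 0"
proof -
  have r: "r \<in> {0<..<1}" "u r > 0" "g r > 0" using assms r2 u_pos[of r] g_pos[of r] by auto
  have "(p - real n) * U r \<le> 0" using assms(1) U_neg[OF r(1)] by (simp add: mult_le_0_iff)
  moreover have "r ^ n * g r > 0" using r by simp
  ultimately have "Z r < 0" unfolding Z_def by linarith
  moreover have "r * y r * ((p - 1) * U r) \<ge> 0"
    using y_neg[OF r(1)] U_neg[OF r(1)] p r(1)
    by (intro mult_nonpos_nonpos) (auto simp: mult_le_0_iff)
  ultimately show ?thesis unfolding P_def using mult_pos_neg[OF r(2), of "Z r"] by linarith
qed

text \<open>
With the Pohozaev function
\<open>E = r^n ((p-1) |u'|^p + p F) + (n-p) r^(n-1) phi(u') u\<close>, here written with \<open>r^n |u'|^p = r u' U\<close>, one has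
\<open>E' = r^(n-1) I\<close> and \<open>P = - E - r^n (u g - p F)\<close>. The boundary values \<open>E 0 = 0\<close> and
\<open>E 1 = (p-1) |u'(1)|^p \<ge> 0\<close> turn each of the sign patterns of \<open>I\<close> into \<open>E > 0\<close> on \<open>(0, r2)\<close>.
\<close>

lemma P_neg_pohozaev:
  fixes F Fr I :: "real \<Rightarrow> real"
  assumes F_deriv: "\<And>r. r \<in> {0<..<1} \<Longrightarrow> (F has_real_derivative Fr r + g r * y r) (at r)"
    and F_cont: "continuous_on {0..1} F" and F_1: "F 1 = 0"
    and I: "\<And>r. I r = real n * p * F r - (real n - p) * u r * g r + p * r * Fr r"
    and superlinear: "\<And>r. r \<in> {0<..<r2} \<Longrightarrow> u r * g r - p * F r > 0"
    and I_sign: "(\<forall>r\<in>{0<..<r2}. I r > 0) \<or> (\<forall>r\<in>{0<..<1}. I r < 0) \<or>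
        (\<exists>r0\<in>{0<..<1}. (\<forall>r\<in>{0<..<r0}. I r > 0) \<and> (\<forall>r\<in>{r0<..<1}. I r < 0))"
    and r: "r \<in> {0<..<r2}"
  shows "P r < 0"
proof -
  define E where "E = (\<lambda>r. r * (y r * ((p - 1) * U r)) + p * (r ^ n * F r) + (real n - p) * (U r * u r))"
  have E_deriv: "(E has_real_derivative s ^ (n - 1) * I s) (at s)" if s: "s \<in> {0<..<1}" for s
  proof -
    have "(y s + s * y' s) * ((p - 1) * U s) = y s * Z s"
      by (simp only: a_y[symmetric] Z_eq[OF s, symmetric] mult_ac)
    then have *: "(p - 1) * U s * (y s + s * y' s) = y s * Z s" by (simp only: mult.commute)
    note D = DERIV_add[OF DERIV_add[OF DERIV_mult[OF DERIV_ident DERIV_mult[OF y_deriv[OF s] DERIV_cmult[OF U_deriv[OF s], of "p - 1"]]]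
               DERIV_cmult[OF DERIV_mult[OF pow_n_deriv F_deriv[OF s]], of p]]
             DERIV_cmult[OF DERIV_mult[OF U_deriv[OF s] u_deriv_at[OF s]], of "real n - p"]]
    show ?thesis unfolding E_def
    proof (rule DERIV_cong[OF D])
      have "1 * (y s * ((p - 1) * U s)) + (y' s * ((p - 1) * U s) + (p - 1) * (- (s ^ (n - 1) * g s)) * y s) * s
            = (p - 1) * U s * (y s + s * y' s) - (p - 1) * (s ^ n * g s * y s)"
        by (simp add: pow_n algebra_simps)
      also have "\<dots> = y s * Z s - (p - 1) * (s ^ n * g s * y s)"
        unfolding * ..
      finally show "1 * (y s * ((p - 1) * U s)) + (y' s * ((p - 1) * U s) + (p - 1) * (- (s ^ (n - 1) * g s)) * y s) * s
            + p * (real n * s ^ (n - 1) * F s + (Fr s + g s * y s) * s ^ n)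
            + (real n - p) * (- (s ^ (n - 1) * g s) * u s + y s * U s) = s ^ (n - 1) * I s"
        by (simp add: Z_def I pow_n algebra_simps)
    qed
  qed
  have E_cont: "continuous_on {0..1} E"
    unfolding E_def by (intro continuous_intros y_cont U_cont F_cont u_cont)
  have E_0: "E 0 = 0" using n by (simp add: E_def U_0)
  have E_1: "E 1 \<ge> 0"
    using y_1_le U_1_le p by (auto simp: E_def F_1 u_1 intro!: mult_nonpos_nonpos mult_nonneg_nonpos)
  have inc: "E s < E t" if "0 \<le> s" "s < t" "t \<le> 1" "\<And>x. x \<in> {s<..<t} \<Longrightarrow> I x > 0" for s t
  proof (rule DERIV_pos_imp_increasing_open[where f = E])
    fix x assume "s < x" "x < t"
    then show "\<exists>d. (E has_real_derivative d) (at x) \<and> 0 < d"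
      using that E_deriv[of x] by (intro exI[of _ "x ^ (n - 1) * I x"]) auto
  qed (use that in \<open>auto intro: continuous_on_subset[OF E_cont]\<close>)
  have dec: "E t < E s" if "0 \<le> s" "s < t" "t \<le> 1" "\<And>x. x \<in> {s<..<t} \<Longrightarrow> I x < 0" for s t
  proof (rule DERIV_neg_imp_decreasing_open[where f = E])
    fix x assume "s < x" "x < t"
    then show "\<exists>d. (E has_real_derivative d) (at x) \<and> d < 0"
      using that E_deriv[of x] by (intro exI[of _ "x ^ (n - 1) * I x"]) (auto simp: mult_pos_neg)
  qed (use that in \<open>auto intro: continuous_on_subset[OF E_cont]\<close>)
  have "E r > 0"
    using I_sign
  proof (elim disjE bexE conjE)
    assume "\<forall>r\<in>{0<..<r2}. I r > 0"
    then show ?thesis using inc[of 0 r] r r2 E_0 by auto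
  next
    \<comment> \<open>Here \<open>E\<close> would decrease from 0 to a value that is not negative.\<close>
    assume "\<forall>r\<in>{0<..<1}. I r < 0"
    then show ?thesis using dec[of 0 1] E_0 E_1 by auto
  next
    fix r0 assume r0: "r0 \<in> {0<..<1}" "\<forall>r\<in>{0<..<r0}. I r > 0" "\<forall>r\<in>{r0<..<1}. I r < 0"
    show ?thesis
    proof (cases "r \<le> r0")
      case True
      then show ?thesis using inc[of 0 r] r r0 E_0 by auto
    next
      case False
      then show ?thesis using dec[of r 1] r r0 r2 E_1 by auto
    qed
  qed
  moreover have "r ^ n * (u r * g r - p * F r) > 0" using superlinear[OF r] r by simp
  moreover have "P r = - E r - r ^ n * (u r * g r - p * F r)"
    by (simp add: P_def E_def Z_def algebra_simps)
  ultimately show ?thesis by linarith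
qed

definition alpha_u :: "real \<Rightarrow> real" where
  "alpha_u r = (p * g r + r * gr r) / (u r * gu r - (p - 1) * g r)"

end

section \<open>Zeros of solutions of the linearized problem\<close>

locale nodal_comparison = radial_solution +
  assumes gr_nonpos: "\<And>r. r \<in> {0<..<1} \<Longrightarrow> gr r \<le> 0"
    and Q_pos: "\<And>r. r \<in> {0<..<1} \<Longrightarrow> u r * gu r - (p - 1) * g r > 0"
    and alpha_u_antimono: "\<And>r s. 0 < r \<Longrightarrow> r \<le> s \<Longrightarrow> s < 1 \<Longrightarrow> alpha_u s \<le> alpha_u r"
    and P_neg: "\<And>r. r \<in> {0<..<r2} \<Longrightarrow> P r < 0"
begin

lemma h_less: "0 < s \<Longrightarrow> s < t \<Longrightarrow> t < r2 \<Longrightarrow> h s < h t"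
  using h_increasing P_neg by blast

lemma xi_eq: "r \<in> {0<..<1} \<Longrightarrow> r * y r + \<gamma> * u r = u r * (\<gamma> - h r)"
  using u_pos[of r] by (simp add: h_def field_simps)

lemma alpha_u_neg: "r \<in> {r2<..<1} \<Longrightarrow> alpha_u r < 0"
proof -
  assume r: "r \<in> {r2<..<1}"
  then have r': "r \<in> {0<..<1}" using r2 by auto
  have "p * g r + r * gr r < 0"
    using g_neg[OF r] gr_nonpos[OF r'] p r' by (intro add_neg_nonpos) (auto simp: mult_pos_neg mult_nonneg_nonpos)
  then show ?thesis unfolding alpha_u_def using Q_pos[OF r'] by (simp add: divide_neg_pos)
qed

lemma G_deriv_alpha:
  assumes "lin_pair w V" "r \<in> {0<..<1}"
  shows "(G w V \<gamma> has_real_derivative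
    r ^ (n - 1) * w r * (u r * gu r - (p - 1) * g r) * (\<gamma> - alpha_u r)) (at r)"
proof -
  have "q * (\<gamma> - s / q) = \<gamma> * q - s" if "q > 0" for q s :: real
    using that by (simp add: field_simps)
  from this[OF Q_pos[OF assms(2)]] show ?thesis
    using G_deriv[OF assms, of \<gamma>] unfolding alpha_u_def by (simp only: mult.assoc)
qed

lemma G_increasing:
  assumes wV: "lin_pair w V" and st: "0 \<le> s" "s < t" "t \<le> 1"
    and pos: "\<And>r. r \<in> {s<..<t} \<Longrightarrow> w r > 0" and al: "\<And>r. r \<in> {s<..<t} \<Longrightarrow> alpha_u r < \<gamma>"
  shows "G w V \<gamma> s < G w V \<gamma> t"
proof (rule DERIV_pos_imp_increasing_open[where f = "G w V \<gamma>"])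
  show "continuous_on {s..t} (G w V \<gamma>)" using st by (auto intro: continuous_on_subset[OF G_cont[OF wV]])
  fix r assume "s < r" "r < t"
  then have r: "r \<in> {s<..<t}" "r \<in> {0<..<1}" using st by auto
  have "r ^ (n - 1) * w r * (u r * gu r - (p - 1) * g r) * (\<gamma> - alpha_u r) > 0"
    using r Q_pos[OF r(2)] pos[OF r(1)] al[OF r(1)] by (intro mult_pos_pos) auto
  then show "\<exists>d. (G w V \<gamma> has_real_derivative d) (at r) \<and> 0 < d"
    using G_deriv_alpha[OF wV r(2)] by blast
qed (use st in auto)

lemma G_decreasing:
  assumes wV: "lin_pair w V" and st: "0 \<le> s" "s < t" "t \<le> 1"
    and pos: "\<And>r. r \<in> {s<..<t} \<Longrightarrow> w r > 0" and al: "\<And>r. r \<in> {s<..<t} \<Longrightarrow> \<gamma> < alpha_u r"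
  shows "G w V \<gamma> t < G w V \<gamma> s"
proof (rule DERIV_neg_imp_decreasing_open[where f = "G w V \<gamma>"])
  show "continuous_on {s..t} (G w V \<gamma>)" using st by (auto intro: continuous_on_subset[OF G_cont[OF wV]])
  fix r assume "s < r" "r < t"
  then have r: "r \<in> {s<..<t}" "r \<in> {0<..<1}" using st by auto
  have "r ^ (n - 1) * w r * (u r * gu r - (p - 1) * g r) * (\<gamma> - alpha_u r) < 0"
    using r Q_pos[OF r(2)] pos[OF r(1)] al[OF r(1)] by (intro mult_pos_neg mult_pos_pos) auto
  then show "\<exists>d. (G w V \<gamma> has_real_derivative d) (at r) \<and> d < 0"
    using G_deriv_alpha[OF wV r(2)] by blast
qed (use st in auto)

lemma G_nondecreasing:
  assumes wV: "lin_pair w V" and st: "0 \<le> s" "s < t" "t \<le> 1"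
    and pos: "\<And>r. r \<in> {s<..<t} \<Longrightarrow> w r > 0" and al: "\<And>r. r \<in> {s<..<t} \<Longrightarrow> alpha_u r \<le> \<gamma>"
  shows "G w V \<gamma> s \<le> G w V \<gamma> t"
proof (rule DERIV_nonneg_imp_increasing_open[where f = "G w V \<gamma>"])
  show "continuous_on {s..t} (G w V \<gamma>)" using st by (auto intro: continuous_on_subset[OF G_cont[OF wV]])
  fix r assume "s < r" "r < t"
  then have r: "r \<in> {s<..<t}" "r \<in> {0<..<1}" using st by auto
  have "r ^ (n - 1) * w r * (u r * gu r - (p - 1) * g r) * (\<gamma> - alpha_u r) \<ge> 0"
    using r Q_pos[OF r(2)] pos[OF r(1)] al[OF r(1)] by (intro mult_nonneg_nonneg) auto
  then show "\<exists>d. (G w V \<gamma> has_real_derivative d) (at r) \<and> 0 \<le> d"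
    using G_deriv_alpha[OF wV r(2)] by blast
qed (use st in auto)

lemma y_nonpos: "r \<in> {0<..1} \<Longrightarrow> y r \<le> 0"
  using y_neg[of r] y_1_le by (cases "r = 1") auto

text \<open>
Suppose \<open>V t > 0\<close> and take \<open>\<gamma> = 0\<close>. To the right of \<open>r2\<close>, \<open>\<alpha> < 0\<close> makes the Wronskian increase on an interval where \<open>w > 0\<close>,
whereas \<open>\<xi> = r u'\<close> is negative, so that the Wronskian is positive at the left end and not positive at
the right end. Applied to \<open>w\<close> and \<open>- w\<close>, this leaves only \<open>V t = 0\<close>.
\<close>

lemma flux_le_beyond_r2:
  assumes wV: "lin_pair w V" and t: "r2 \<le> t" "t < 1" "w t = 0"
  shows "V t \<le> 0"
proof (rule ccontr)
  assume "\<not> V t \<le> 0"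
  then have Vt: "V t > 0" by simp
  have t': "t \<in> {0<..<1}" using t r2 by auto
  obtain \<tau> where \<tau>: "\<tau> \<in> {t<..1}" "w \<tau> = 0" "\<And>r. r \<in> {t<..<\<tau>} \<Longrightarrow> w r > 0"
    using nodal_interval_right[OF wV t' t(3) Vt] by blast
  have "V \<tau> \<le> 0" using \<tau> t' by (intro flux_sign_right_end[OF wV, of t]) auto
  then have "G w V 0 \<tau> \<le> 0"
    using y_nonpos[of \<tau>] \<tau> t' by (simp add: G_zero mult_nonpos_nonpos mult_nonneg_nonpos)
  moreover have "G w V 0 t < G w V 0 \<tau>"
    using \<tau> t t' alpha_u_neg by (intro G_increasing[OF wV]) auto
  moreover have "G w V 0 t > 0"
    using y_neg[OF t'] t' Vt t(3) by (simp add: G_zero mult_pos_neg mult_neg_pos)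
  ultimately show False by linarith
qed

lemma flux_zero_beyond_r2:
  assumes "lin_pair w V" "r2 \<le> t" "t < 1" "w t = 0"
  shows "V t = 0"
  using flux_le_beyond_r2[OF assms] flux_le_beyond_r2[OF lin_pair_minus[OF assms(1)] assms(2,3)] assms(4)
  by simp

text \<open>
Take \<open>\<gamma> = h t\<close>. If \<open>w\<close> were positive on an interval to the left of \<open>t\<close>, then, as \<open>\<gamma> < \<alpha>\<close> there, the
Wronskian would decrease strictly to its value 0 at \<open>t\<close>. At the left end of the interval it is
not positive: either this end is 0, or \<open>\<xi> > 0\<close> there because \<open>h\<close> increases.
\<close>

lemma flux_ge_before_crossing:
  assumes wV: "lin_pair w V" and t: "0 < t" "t < r2" "w t = 0" and cross: "h t < alpha_u t"
  shows "V t \<ge> 0"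
proof (rule ccontr)
  assume "\<not> V t \<ge> 0"
  then have Vt: "V t < 0" by simp
  have t': "t \<in> {0<..<1}" using t r2 by auto
  obtain \<sigma> where \<sigma>: "\<sigma> \<in> {0..<t}" "\<sigma> = 0 \<or> w \<sigma> = 0" "\<And>r. r \<in> {\<sigma><..<t} \<Longrightarrow> w r > 0"
    using nodal_interval_left[OF wV t' t(3) Vt] by blast
  have "h t < alpha_u r" if "r \<in> {\<sigma><..<t}" for r
    using alpha_u_antimono[of r t] that \<sigma>(1) t' cross by auto
  then have "G w V (h t) t < G w V (h t) \<sigma>"
    using \<sigma> t' by (intro G_decreasing[OF wV]) auto
  moreover have "G w V (h t) t = 0" using t' t(3) by (simp add: G_zero xi_eq)
  moreover have "G w V (h t) \<sigma> \<le> 0"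
  proof (cases "\<sigma> = 0")
    case True
    then show ?thesis using G_0[OF wV] by simp
  next
    case False
    then have s: "\<sigma> \<in> {0<..<1}" "w \<sigma> = 0" using \<sigma> t' by auto
    have "V \<sigma> \<ge> 0" using \<sigma> s t' by (intro flux_sign_left_end[OF wV, of \<sigma> t]) auto
    moreover have "u \<sigma> * (h t - h \<sigma>) \<ge> 0"
      using u_pos[of \<sigma>] h_less[of \<sigma> t] s \<sigma> t by auto
    ultimately show ?thesis using s by (simp add: G_zero xi_eq)
  qed
  ultimately show False by linarith
qed

text \<open>
Take \<open>\<gamma> = h t\<close>. On an interval to the right of \<open>t\<close> where \<open>w > 0\<close>, \<open>\<alpha> \<le> \<gamma>\<close>, and the Wronskian does not
decrease from its value 0 at \<open>t\<close>. Since \<open>\<alpha>\<close> may be constant, strictness has to come from the right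
end \<open>\<tau>\<close>. Before \<open>r2\<close>, and at 1 if \<open>r2 = 1\<close>, both \<open>\<xi>\<close> and \<open>V\<close> are strictly negative at \<open>\<tau>\<close>, which
makes the Wronskian negative. If \<open>\<tau> = 1\<close> and \<open>r2 < 1\<close>, then \<open>u'(1)\<close> may vanish, but \<open>\<alpha> < 0 < \<gamma>\<close> beyond
\<open>r2\<close> makes the Wronskian increase strictly. The remaining case \<open>r2 \<le> \<tau> < 1\<close> is excluded by
\<open>flux_zero_beyond_r2\<close> and uniqueness.
\<close>

lemma flux_le_after_crossing:
  assumes wV: "lin_pair w V" and t: "0 < t" "t < r2" "w t = 0" and cross: "alpha_u t \<le> h t"
  shows "V t \<le> 0"
proof (rule ccontr)
  assume "\<not> V t \<le> 0"
  then have Vt: "V t > 0" by simp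
  have t': "t \<in> {0<..<1}" using t r2 by auto
  obtain \<tau> where \<tau>: "\<tau> \<in> {t<..1}" "w \<tau> = 0" "\<And>r. r \<in> {t<..<\<tau>} \<Longrightarrow> w r > 0"
    using nodal_interval_right[OF wV t' t(3) Vt] by blast
  have V_le: "V \<tau> \<le> 0" using \<tau> t' by (intro flux_sign_right_end[OF wV, of t]) auto
  have V_ne: "V \<tau> \<noteq> 0" if "y \<tau> < 0 \<or> \<tau> < 1"
  proof
    assume "V \<tau> = 0"
    define s where "s = (t + \<tau>) / 2"
    have s: "s \<in> {t<..<\<tau>}" using \<tau>(1) by (auto simp: s_def)
    have "w s = 0"
    proof (rule lin_pair_unique[OF wV])
      show "0 < t" "\<tau> \<le> 1" "\<tau> \<in> {t..\<tau>}" "s \<in> {t..\<tau>}" using t' \<tau>(1) s by auto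
    qed (fact that \<tau>(2) \<open>V \<tau> = 0\<close>)+
    then show False using \<tau>(3)[OF s] by simp
  qed
  have al_le: "alpha_u r \<le> h t" if "r \<in> {t<..<\<tau>}" for r
    using alpha_u_antimono[of t r] that \<tau>(1) t' cross by auto
  have G_t: "G w V (h t) t = 0" using t' t(3) by (simp add: G_zero xi_eq)
  have G_\<tau>: "G w V (h t) \<tau> \<ge> 0"
    using G_nondecreasing[OF wV _ _ _ \<tau>(3) al_le, of t \<tau>] \<tau>(1) t' G_t by auto
  consider "\<tau> < r2" | "r2 \<le> \<tau>" "\<tau> < 1" | "\<tau> = 1" "r2 = 1" | "\<tau> = 1" "r2 < 1"
    using \<tau>(1) r2 by force
  then show False
  proof cases
    case 1
    then have \<tau>': "\<tau> \<in> {0<..<1}" "\<tau> < 1" using \<tau> t' r2 by auto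
    have "u \<tau> * (h t - h \<tau>) < 0"
      using u_pos[of \<tau>] h_less[of t \<tau>] \<tau>' \<tau>(1) t' 1 by (auto simp: mult_pos_neg)
    moreover have "V \<tau> < 0" using V_le V_ne \<tau>'(2) by linarith
    ultimately have "G w V (h t) \<tau> < 0" using \<tau>'(1) \<tau>(2) by (simp add: G_zero xi_eq mult_neg_neg)
    then show False using G_\<tau> by simp
  next
    case 2
    then show False using flux_zero_beyond_r2[OF wV 2 \<tau>(2)] V_ne by blast
  next
    case 3
    then have "y 1 < 0" using y_1_neg by simp
    moreover have "V 1 < 0" using V_le V_ne 3 \<open>y 1 < 0\<close> by force
    ultimately have "G w V (h t) 1 < 0" using 3 \<tau>(2) u_1 by (simp add: G_zero mult_neg_neg)
    then show False using G_\<tau> 3 by simp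
  next
    case 4
    have "h t > 0"
      using y_neg[OF t'] t' u_pos[of t] by (simp add: h_def mult_pos_neg divide_neg_pos)
    then have al_less: "alpha_u r < h t" if "r \<in> {r2<..<1}" for r using alpha_u_neg[OF that] by simp
    have "G w V (h t) t \<le> G w V (h t) r2"
      using \<tau>(3) al_le 4 t' t by (intro G_nondecreasing[OF wV]) auto
    also have "\<dots> < G w V (h t) 1"
      using \<tau>(3) 4 t r2 al_less by (intro G_increasing[OF wV]) auto
    finally have "G w V (h t) 1 > 0" using G_t by simp
    moreover have "G w V (h t) 1 \<le> 0"
      using 4 \<tau>(2) u_1 y_1_le V_le by (simp add: G_zero mult_nonpos_nonpos)
    ultimately show False by simp
  qed
qed

lemma flux_zero_at_interior_zero:
  assumes wV: "lin_pair w V" and t: "t \<in> {0<..<1}" "w t = 0"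
  shows "V t = 0"
proof -
  note mV = lin_pair_minus[OF wV]
  consider "r2 \<le> t" | "t < r2" "h t < alpha_u t" | "t < r2" "alpha_u t \<le> h t" by linarith
  then show ?thesis
  proof cases
    case 1
    then show ?thesis using flux_zero_beyond_r2[OF wV] t by simp
  next
    case 2
    then show ?thesis
      using flux_ge_before_crossing[OF wV, of t] flux_ge_before_crossing[OF mV, of t] t by simp
  next
    case 3
    then show ?thesis
      using flux_le_after_crossing[OF wV, of t] flux_le_after_crossing[OF mV, of t] t by simp
  qed
qed

text \<open>
\<open>K\<close> is the Wronskian of \<open>u\<close> and \<open>w\<close>, since \<open>(p-1) U\<close> is the flux \<open>r^(n-1) phi'(u') u'\<close>.
\<close>

lemma not_positive:
  assumes wV: "lin_pair w V" and pos: "\<And>r. r \<in> {0<..<1} \<Longrightarrow> w r > 0"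
  shows False
proof -
  define K where "K = (\<lambda>r. (p - 1) * U r * w r - u r * V r)"
  have "K 0 < K 1"
  proof (rule DERIV_pos_imp_increasing_open[where f = K])
    show "continuous_on {0..1} K" unfolding K_def
      by (intro continuous_on_diff continuous_on_mult continuous_on_const U_cont u_cont lin_pairD(1,2)[OF wV])
    fix r :: real assume "0 < r" "r < 1"
    then have r: "r \<in> {0<..<1}" by auto
    let ?c = "r ^ (n - 1) * a r"
    have "v / c * (c * x) = x * v" if "c > 0" for v c x :: real
      using that by simp
    from this[OF weight_pos[OF r], of "V r" "y r"]
    have *: "V r / ?c * ((p - 1) * U r) = y r * V r" unfolding a_y .
    note D = DERIV_diff[OF DERIV_mult[OF DERIV_cmult[OF U_deriv[OF r], of "p - 1"] lin_pairD(5)[OF wV r]]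
                           DERIV_mult[OF u_deriv_at[OF r] lin_pairD(6)[OF wV r]]]
    have "(K has_real_derivative r ^ (n - 1) * w r * (u r * gu r - (p - 1) * g r)) (at r)"
      unfolding K_def by (rule DERIV_cong[OF D], unfold *) (simp add: algebra_simps)
    moreover have "r ^ (n - 1) * w r * (u r * gu r - (p - 1) * g r) > 0"
      using r Q_pos[OF r] pos[OF r] by simp
    ultimately show "\<exists>d. (K has_real_derivative d) (at r) \<and> 0 < d" by blast
  qed auto
  then show False using lin_pairD(3,4)[OF wV] u_1 U_0 by (simp add: K_def)
qed

lemma not_positive_at:
  assumes wV: "lin_pair w V" and r0: "r0 \<in> {0<..<1}" "w r0 > 0"
  shows False
proof -
  have nz: "w t \<noteq> 0" if t: "t \<in> {0<..<1}" for t
  proof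
    assume "w t = 0"
    have "w r0 = 0"
    proof (rule lin_pair_unique[OF wV])
      show "0 < min t r0" "max t r0 \<le> 1" "y (max t r0) < 0 \<or> max t r0 < 1"
        "t \<in> {min t r0..max t r0}" "r0 \<in> {min t r0..max t r0}"
        using t r0(1) by (simp_all add: max_def min_def)
    qed (fact \<open>w t = 0\<close> flux_zero_at_interior_zero[OF wV t \<open>w t = 0\<close>])+
    then show False using r0 by simp
  qed
  have "w r > 0" if r: "r \<in> {0<..<1}" for r
  proof (rule ccontr)
    assume "\<not> w r > 0"
    then have le: "w r \<le> 0" by simp
    have cont: "continuous_on {min r r0..max r r0} w"
      using r r0 by (intro continuous_on_subset[OF lin_pairD(1)[OF wV]]) auto
    have "\<exists>x. min r r0 \<le> x \<and> x \<le> max r r0 \<and> w x = 0"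
    proof (cases "r \<le> r0")
      case True
      then show ?thesis using IVT'[of w r 0 r0] le r0 cont by (auto simp: min_def max_def)
    next
      case False
      then show ?thesis using IVT2'[of w r 0 r0] le r0 cont by (auto simp: min_def max_def)
    qed
    then obtain x where "min r r0 \<le> x" "x \<le> max r r0" "w x = 0" by blast
    moreover from this have "x \<in> {0<..<1}" using r r0 by (auto simp: min_def max_def split: if_splits)
    ultimately show False using nz by blast
  qed
  then show False by (rule not_positive[OF wV])
qed

lemma lin_pair_trivial:
  assumes wV: "lin_pair w V" and r: "r \<in> {0..1}"
  shows "w r = 0"
proof -
  have "w s = 0" if "s \<in> {0<..<1}" for s
    using not_positive_at[OF wV that] not_positive_at[OF lin_pair_minus[OF wV] that]
    by (meson linorder_neqE_linordered_idom neg_0_less_iff_less)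
  then show ?thesis
    using continuous_constant_on_closure[of "{0<..<1::real}" w 0 r] lin_pairD(1)[OF wV] r by simp
qed

end

section \<open>One-sided partial derivatives and the primitive\<close>

lemma D_eqI:
  assumes "(g has_real_derivative d) (at x within S)" "at x within S \<noteq> bot"
  shows "D S g x = d"
  using assms unfolding D_def has_real_derivative_iff_has_vector_derivative
  by (simp add: vector_derivative_within)

lemma C1_on_real:
  fixes g :: "real \<Rightarrow> real"
  assumes C1: "C1_on S g" and S: "\<And>x. x \<in> S \<Longrightarrow> at x within S \<noteq> bot"
  shows "\<And>x. x \<in> S \<Longrightarrow> (g has_real_derivative D S g x) (at x within S)" and "continuous_on S (D S g)"
proof -
  obtain g' where g': "\<And>x. x \<in> S \<Longrightarrow> (g has_derivative blinfun_apply (g' x)) (at x within S)"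
    and cont: "continuous_on S g'"
    using C1 unfolding C1_on_def by blast
  have "(g has_real_derivative blinfun_apply (g' x) 1) (at x within S)" if "x \<in> S" for x
  proof -
    have "blinfun_apply (g' x) = (*) (blinfun_apply (g' x) 1)"
    proof
      fix t :: real
      show "blinfun_apply (g' x) t = blinfun_apply (g' x) 1 * t"
        using blinfun.scaleR_right[of "g' x" t 1] by (simp add: mult.commute)
    qed
    then show ?thesis using g'[OF that] unfolding has_field_derivative_def by simp
  qed
  moreover have eq: "D S g x = blinfun_apply (g' x) 1" if "x \<in> S" for x
    using D_eqI calculation S that by blast
  ultimately show "\<And>x. x \<in> S \<Longrightarrow> (g has_real_derivative D S g x) (at x within S)" by simp
  have "continuous_on S (\<lambda>x. blinfun_apply (g' x) 1)"
    by (intro continuous_intros cont)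
  then show "continuous_on S (D S g)" by (rule continuous_on_eq) (simp add: eq)
qed

lemma at_within_unit_interval: "x \<in> {0..1::real} \<Longrightarrow> at x within {0..1} \<noteq> bot"
  by (simp add: trivial_limit_within islimpt_Icc)

lemma at_within_half_line: "x \<in> {0..} \<Longrightarrow> at x within {0::real..} \<noteq> bot"
proof -
  assume "x \<in> {0..}"
  then have "at x within {x<..} \<le> at x within {0..}" by (intro at_le) auto
  then show ?thesis using trivial_limit_at_right_real[of x] by (metis bot.extremum_uniqueI)
qed

lemma at_within_punctured:
  assumes "x \<in> {0<..1::real}" shows "at x within {0<..1} = at x within {0..1}"
  by (rule at_within_nhd[of x "{0<..}"]) (use assms in auto)

definition strip :: "(real \<times> real) set" where "strip = {0..1} \<times> {0..}"

lemma C1_on_strip: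
  assumes C1: "C1_on strip (\<lambda>(r, s). f r s)"
  shows "\<And>r s. (r, s) \<in> strip \<Longrightarrow>
      ((\<lambda>(r, s). f r s) has_derivative (\<lambda>(x, z). part_r f r s * x + part_u f r s * z)) (at (r, s) within strip)"
    and "continuous_on strip (\<lambda>(r, s). part_r f r s)" "continuous_on strip (\<lambda>(r, s). part_u f r s)"
    and "continuous_on strip (\<lambda>(r, s). f r s)"
proof -
  obtain f' where f': "\<And>z. z \<in> strip \<Longrightarrow> ((\<lambda>(r, s). f r s) has_derivative blinfun_apply (f' z)) (at z within strip)"
    and cont: "continuous_on strip f'"
    using C1 unfolding C1_on_def by blast
  show "continuous_on strip (\<lambda>(r, s). f r s)"
    by (rule has_derivative_continuous_on[where f' = "\<lambda>z. blinfun_apply (f' z)"]) (rule f')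
  have r: "part_r f r s = blinfun_apply (f' (r, s)) (1, 0)" if rs: "(r, s) \<in> strip" for r s
    unfolding part_r_def
  proof (rule D_eqI)
    have "((\<lambda>x. case (x, s) of (r, s) \<Rightarrow> f r s) has_derivative (\<lambda>t. blinfun_apply (f' (r, s)) (t, 0))) (at r within {0..1})"
      by (rule has_derivative_in_compose2[where t = strip, OF f'])
         (use rs in \<open>auto simp: strip_def intro!: derivative_eq_intros\<close>)
    moreover have "(\<lambda>t. blinfun_apply (f' (r, s)) (t, 0)) = (*) (blinfun_apply (f' (r, s)) (1, 0))"
    proof
      show "blinfun_apply (f' (r, s)) (t, 0) = blinfun_apply (f' (r, s)) (1, 0) * t" for t
        using blinfun.scaleR_right[of "f' (r, s)" t "(1, 0)"] by (simp add: mult.commute)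
    qed
    ultimately show "((\<lambda>x. f x s) has_real_derivative blinfun_apply (f' (r, s)) (1, 0)) (at r within {0..1})"
      by (simp only: has_field_derivative_def prod.case)
  qed (use rs at_within_unit_interval in \<open>auto simp: strip_def\<close>)
  have u: "part_u f r s = blinfun_apply (f' (r, s)) (0, 1)" if rs: "(r, s) \<in> strip" for r s
    unfolding part_u_def
  proof (rule D_eqI)
    have "((\<lambda>x. case (r, x) of (r, s) \<Rightarrow> f r s) has_derivative (\<lambda>t. blinfun_apply (f' (r, s)) (0, t))) (at s within {0..})"
      by (rule has_derivative_in_compose2[where t = strip, OF f'])
         (use rs in \<open>auto simp: strip_def intro!: derivative_eq_intros\<close>)
    moreover have "(\<lambda>t. blinfun_apply (f' (r, s)) (0, t)) = (*) (blinfun_apply (f' (r, s)) (0, 1))"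
    proof
      show "blinfun_apply (f' (r, s)) (0, t) = blinfun_apply (f' (r, s)) (0, 1) * t" for t
        using blinfun.scaleR_right[of "f' (r, s)" t "(0, 1)"] by (simp add: mult.commute)
    qed
    ultimately show "((f r) has_real_derivative blinfun_apply (f' (r, s)) (0, 1)) (at s within {0..})"
      by (simp only: has_field_derivative_def prod.case)
  qed (use rs at_within_half_line in \<open>auto simp: strip_def\<close>)
  show "((\<lambda>(r, s). f r s) has_derivative (\<lambda>(x, z). part_r f r s * x + part_u f r s * z)) (at (r, s) within strip)"
    if rs: "(r, s) \<in> strip" for r s
  proof -
    have "blinfun_apply (f' (r, s)) (x, z) = part_r f r s * x + part_u f r s * z" for x z
      using blinfun.scaleR_right[of "f' (r, s)" x "(1, 0)"] blinfun.scaleR_right[of "f' (r, s)" z "(0, 1)"]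
        blinfun.add_right[of "f' (r, s)" "(x, 0)" "(0, z)"]
      by (simp add: r[OF rs] u[OF rs] mult.commute)
    then have "blinfun_apply (f' (r, s)) = (\<lambda>(x, z). part_r f r s * x + part_u f r s * z)" by auto
    then show ?thesis using f'[OF rs] by simp
  qed
  have "continuous_on strip (\<lambda>z. blinfun_apply (f' z) (1, 0))"
    by (intro continuous_intros cont)
  then show "continuous_on strip (\<lambda>(r, s). part_r f r s)"
    by (rule continuous_on_eq) (auto simp: r)
  have "continuous_on strip (\<lambda>z. blinfun_apply (f' z) (0, 1))"
    by (intro continuous_intros cont)
  then show "continuous_on strip (\<lambda>(r, s). part_u f r s)"
    by (rule continuous_on_eq) (auto simp: u)
qed

lemma derivative_along_graph:
  fixes u :: "real \<Rightarrow> real"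
  assumes f: "((\<lambda>(r, s). f r s) has_derivative (\<lambda>(x, z). A * x + B * z)) (at (r, u r) within strip)"
    and u: "(u has_real_derivative d) (at r within {0..1})"
    and nonneg: "\<And>r. r \<in> {0..1} \<Longrightarrow> u r \<ge> 0"
  shows "((\<lambda>r. f r (u r)) has_real_derivative A + B * d) (at r within {0..1})"
proof -
  have "((\<lambda>r. (r, u r)) has_derivative (\<lambda>t. (t, d * t))) (at r within {0..1})"
    using u by (auto intro!: derivative_intros simp: has_field_derivative_def)
  moreover have "((\<lambda>(r, s). f r s) has_derivative (\<lambda>(x, z). A * x + B * z))
      (at (r, u r) within (\<lambda>r. (r, u r)) ` {0..1})"
    by (rule has_derivative_subset[OF f]) (use nonneg in \<open>auto simp: strip_def\<close>)
  ultimately have "((\<lambda>x. case (x, u x) of (r, s) \<Rightarrow> f r s) has_derivative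
      (\<lambda>t. case (t, d * t) of (x, z) \<Rightarrow> A * x + B * z)) (at r within {0..1})"
    by (rule has_derivative_in_compose)
  moreover have "(\<lambda>t. A * t + B * (d * t)) = (*) (A + B * d)"
    by (auto simp: algebra_simps)
  ultimately show ?thesis by (simp add: has_field_derivative_def)
qed

text \<open>
The derivative in \<open>r\<close> exists by differentiation under the integral sign, the one in \<open>s\<close> by the
fundamental theorem of calculus; as the latter is jointly continuous, \<open>primitive f\<close> is
differentiable as a function of two variables.
\<close>

lemma primitive_derivative:
  assumes C1: "C1_on strip (\<lambda>(r, s). f r s)" and rs: "(r, s) \<in> strip"
  shows "((\<lambda>(r, s). primitive f r s) has_derivative (\<lambda>(x, z). part_r (primitive f) r s * x + f r s * z))
    (at (r, s) within strip)"
proof -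
  note cont = C1_on_strip(4)[OF C1]
  have cont_r: "continuous_on {0..s} (f r)" if "r \<in> {0..1}" for r s
  proof -
    have "continuous_on {0..s} (\<lambda>t. case (r, t) of (r, s) \<Rightarrow> f r s)"
      by (rule continuous_on_compose2[OF cont])
         (use that in \<open>auto simp: strip_def intro!: continuous_on_Pair continuous_on_const continuous_on_id\<close>)
    then show ?thesis by simp
  qed
  have fr: "((\<lambda>x. f x t) has_real_derivative part_r f x t) (at x within {0..1})" if "x \<in> {0..1}" "t \<ge> 0" for x t
    using derivative_along_graph[where u = "\<lambda>_. t" and d = 0, OF C1_on_strip(1)[OF C1]] that
    by (auto simp: strip_def)
  have "((\<lambda>x. integral (cbox 0 s) (f x)) has_real_derivative integral (cbox 0 s) (part_r f r)) (at r within {0..1})"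
  proof (rule leibniz_rule_field_derivative)
    show "continuous_on ({0..1} \<times> cbox 0 s) (\<lambda>(x, t). part_r f x t)"
      by (rule continuous_on_subset[OF C1_on_strip(2)[OF C1]]) (auto simp: strip_def)
  qed (use rs fr cont_r in \<open>auto simp: strip_def intro!: integrable_continuous_real\<close>)
  then have 1: "((\<lambda>x. primitive f x s) has_real_derivative part_r (primitive f) r s) (at r within {0..1})"
    using D_eqI[of "\<lambda>x. primitive f x s"] at_within_unit_interval[of r] rs
    unfolding part_r_def by (auto simp: primitive_def strip_def)
  have 2: "(primitive f x has_real_derivative f x t) (at t within {0..})" if "x \<in> {0..1}" "t \<ge> 0" for x t
  proof -
    have "((\<lambda>t. integral {0..t} (f x)) has_real_derivative f x t) (at t within {0..t + 1})"
      using that by (intro integral_has_real_derivative cont_r) auto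
    moreover have "at t within {0..t + 1} = at t within {0..}"
      by (rule at_within_nhd[of t "{..<t + 1}"]) auto
    ultimately show ?thesis by (simp add: primitive_def[abs_def])
  qed
  have "((\<lambda>(x, y). primitive f x y) has_derivative
     (\<lambda>(tx, ty). part_r (primitive f) r s * tx + blinfun_mult_right (f r s) ty)) (at (r, s) within {0..1} \<times> {0..})"
  proof (rule has_derivative_partialsI)
    show "((\<lambda>x. primitive f x s) has_derivative (*) (part_r (primitive f) r s)) (at r within {0..1})"
      using 1 by (simp add: has_field_derivative_def)
    show "(primitive f x has_derivative blinfun_apply (blinfun_mult_right (f x t))) (at t within {0..})"
      if "x \<in> {0..1}" "t \<in> {0..}" for x t
      using 2[of x t] that by (simp add: has_field_derivative_def)
    have "continuous_on strip (\<lambda>z. blinfun_mult_right (case z of (x, t) \<Rightarrow> f x t))"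
      by (rule bounded_linear.continuous_on[OF bounded_linear_blinfun_mult_right cont])
    moreover have "(\<lambda>z. blinfun_mult_right (case z of (x, t) \<Rightarrow> f x t)) = (\<lambda>(x, t). blinfun_mult_right (f x t))"
      by auto
    ultimately have "continuous_on strip (\<lambda>(x, t). blinfun_mult_right (f x t))" by (simp only:)
    then show "continuous (at (r, s) within {0..1} \<times> {0..}) (\<lambda>(x, t). blinfun_mult_right (f x t))"
      using rs unfolding continuous_on_eq_continuous_within strip_def by blast
  qed (use rs in \<open>auto simp: strip_def\<close>)
  then show ?thesis by (simp add: strip_def)
qed

section \<open>Nondegeneracy\<close>

theorem theorem2p1:
  fixes n :: nat and p :: real and f :: "real \<Rightarrow> real \<Rightarrow> real"
    and u :: "real \<Rightarrow> real" and r2 :: real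
  assumes "n \<ge> 1" and "p > 1"
    and "C1_on ({0..1} \<times> {0..}) (\<lambda>(r, s). f r s)"
    and A1: "\<forall>r\<in>{0..1}. f r 0 = 0" "\<forall>r\<in>{0..1}. \<forall>s>0. part_r f r s \<le> 0"
    and A2: "\<exists>c0>0. \<exists>\<delta>>0. \<forall>s r. 0 < s \<and> s < \<delta> \<and> r \<in> {0..1} \<and> 1 - \<delta> < r
               \<longrightarrow> - f r s < c0 * s powr (p - 1)"
    and A3: "\<forall>r\<in>{0..1}. \<forall>s>0. part_r (primitive f) r s \<le> 0"
    and A4: "\<forall>r0\<in>{0..<1}. (\<forall>s>0. f r0 s > 0) \<or>
               (\<exists>s0>0. (\<forall>s. 0 < s \<and> s < s0 \<longrightarrow> f r0 s < 0) \<and> (\<forall>s>s0. f r0 s > 0))"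
    and A5: "\<forall>r\<in>{0..1}. \<forall>s>0. s * part_u f r s - (p - 1) * f r s > 0"
    and A6: "\<forall>v. positive_solution_P p n f v \<longrightarrow> antimono_on {0<..<1} (alpha p f v)"
    and u: "positive_solution_P p n f u"
    and r2: "r2 \<in> {0<..1}" "\<forall>r\<in>{0..<r2}. f r (u r) > 0"
      "r2 < 1 \<longrightarrow> (\<forall>r\<in>{r2<..<1}. f r (u r) < 0)"
    and A7: "p < real n \<longrightarrow> (\<forall>r\<in>{0<..<r2}. u r * f r (u r) - p * primitive f r (u r) > 0)"
    and A8: "p < real n \<longrightarrow>
        (\<forall>r\<in>{0<..<r2}. I_fun p n f u r > 0) \<or>
        (\<forall>r\<in>{0<..<1}. I_fun p n f u r < 0) \<or>
        (\<exists>r0\<in>{0<..<1}. (\<forall>r\<in>{0<..<r0}. I_fun p n f u r > 0) \<and>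
                        (\<forall>r\<in>{r0<..<1}. I_fun p n f u r < 0))"
  shows "non_degenerate p n f u"
proof -
  define y where "y = D {0..1} u"
  define g where "g = (\<lambda>r. f r (u r))"
  define gu where "gu = (\<lambda>r. part_u f r (u r))"
  define gr where "gr = (\<lambda>r. part_r f r (u r))"
  have n: "n \<ge> 1" and p: "p > 1" by fact+
  have C1: "C1_on strip (\<lambda>(r, s). f r s)" using assms(3) by (simp add: strip_def)
  have sol: "solution_P p n f u" and u_pos: "\<And>r. r \<in> {0..<1} \<Longrightarrow> u r > 0"
    using u by (auto simp: positive_solution_P_def)
  have C1_u: "C1_on {0..1} u" and C1_Phi: "C1_on {0<..1} (\<lambda>r. phi p (y r))"
    and eq: "\<And>r. r \<in> {0<..<1} \<Longrightarrow> D {0<..1} (\<lambda>s. phi p (y s)) r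
          + (real n - 1) / r * phi p (y r) + g r = 0"
    and y_0: "y 0 = 0" and u_1: "u 1 = 0"
    using sol by (auto simp: solution_P_def y_def g_def)
  have u_deriv: "(u has_real_derivative y r) (at r within {0..1})" if "r \<in> {0..1}" for r
    using C1_on_real(1)[OF C1_u at_within_unit_interval] that by (simp add: y_def)
  have y_cont: "continuous_on {0..1} y"
    using C1_on_real(2)[OF C1_u at_within_unit_interval] by (simp add: y_def)
  have u_cont: "continuous_on {0..1} u"
    by (rule DERIV_continuous_on[OF u_deriv])
  have u_nonneg: "u r \<ge> 0" if "r \<in> {0..1}" for r
    using u_pos[of r] u_1 that by (cases "r = 1") auto
  have graph: "(r, u r) \<in> strip" if "r \<in> {0..1}" for r
    using that u_nonneg by (simp add: strip_def)
  have along: "continuous_on {0..1} (\<lambda>r. k r (u r))" if "continuous_on strip (\<lambda>(r, s). k r s)" for k :: "real \<Rightarrow> real \<Rightarrow> real"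
  proof -
    have "continuous_on {0..1} (\<lambda>r. case (r, u r) of (r, s) \<Rightarrow> k r s)"
      by (rule continuous_on_compose2[OF that])
         (use graph in \<open>auto intro!: continuous_on_Pair continuous_on_id u_cont\<close>)
    then show ?thesis by simp
  qed
  have deriv_at: "(k has_real_derivative d) (at r)"
    if "(k has_real_derivative d) (at r within {0..1})" "r \<in> {0<..<1}" for k d and r :: real
    using that at_within_Icc_at[of 0 r 1] by auto
  have flux_deriv: "(k has_real_derivative D {0<..1} k r) (at r)"
    if "C1_on {0<..1} k" "r \<in> {0<..<1}" for k r
    using C1_on_real(1)[OF that(1), of r] deriv_at[of k _ r] at_within_punctured at_within_unit_interval that(2)
    by auto

  have minus: "- (real n - 1) / r * t = - ((real n - 1) / r * t)" for r t
    by (simp only: minus_divide_left[symmetric] mult_minus_left)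

  interpret rs: radial_solution p n u y g gu gr r2
  proof
    show "((\<lambda>r. phi p (y r)) has_real_derivative - (real n - 1) / r * phi p (y r) - g r) (at r)"
      if r: "r \<in> {0<..<1}" for r
    proof (rule DERIV_cong[OF flux_deriv[OF C1_Phi r]])
      show "D {0<..1} (\<lambda>r. phi p (y r)) r = - (real n - 1) / r * phi p (y r) - g r"
        using eq[OF r] minus[of r "phi p (y r)"] by linarith
    qed
    show "(g has_real_derivative gr r + gu r * y r) (at r)" if r: "r \<in> {0<..<1}" for r
      unfolding g_def gr_def gu_def
      by (rule deriv_at[OF derivative_along_graph[OF C1_on_strip(1)[OF C1 graph] u_deriv u_nonneg] r])
         (use r in auto)
    show "continuous_on {0..1} g" "continuous_on {0..1} gu"
      unfolding g_def gu_def by (rule along C1_on_strip[OF C1])+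
  qed (use n p u_deriv y_cont y_0 u_1 u_pos r2 in \<open>auto simp: g_def\<close>)

  have P_neg: "rs.P r < 0" if r: "r \<in> {0<..<r2}" for r
  proof (cases "p < real n")
    case False
    then show ?thesis using rs.P_neg_large_p[of r] r by simp
  next
    case True
    have prim: "((\<lambda>r. primitive f r (u r)) has_real_derivative
        part_r (primitive f) r (u r) + f r (u r) * y r) (at r within {0..1})" if "r \<in> {0..1}" for r
      by (rule derivative_along_graph[OF primitive_derivative[OF C1 graph] u_deriv u_nonneg]) (use that in auto)
    show ?thesis
    proof (rule rs.P_neg_pohozaev[OF _ _ _ _ _ _ r])
      show "((\<lambda>r. primitive f r (u r)) has_real_derivative
          part_r (primitive f) s (u s) + g s * y s) (at s)" if "s \<in> {0<..<1}" for s
        unfolding g_def by (rule deriv_at[OF prim that]) (use that in auto)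
      show "continuous_on {0..1} (\<lambda>r. primitive f r (u r))"
        by (rule DERIV_continuous_on[OF prim])
      show "primitive f 1 (u 1) = 0" by (simp add: u_1 primitive_def)
      show "I_fun p n f u s = real n * p * primitive f s (u s) - (real n - p) * u s * g s
            + p * s * part_r (primitive f) s (u s)" for s
        by (simp add: I_fun_def g_def)
      show "u s * g s - p * primitive f s (u s) > 0" if "s \<in> {0<..<r2}" for s
        using A7 True that by (simp add: g_def)
    qed (use A8 True in blast)
  qed

  have alpha_eq: "rs.alpha_u = alpha p f u"
    by (rule ext, unfold rs.alpha_u_def alpha_def) (simp only: g_def gr_def gu_def)
  interpret nodal_comparison p n u y g gu gr r2
  proof
    show "gr r \<le> 0" if "r \<in> {0<..<1}" for r
      using A1(2) u_pos[of r] that by (simp add: gr_def)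
    show "u r * gu r - (p - 1) * g r > 0" if "r \<in> {0<..<1}" for r
      using A5 u_pos[of r] that by (simp add: gu_def g_def)
    show "rs.alpha_u s \<le> rs.alpha_u r" if "0 < r" "r \<le> s" "s < 1" for r s
      unfolding alpha_eq using that monotone_onD[OF A6[rule_format, OF u], of r s] by auto
  qed (fact P_neg)

  have "w r = 0" if lin: "linearized_solution p n f u w" and r: "r \<in> {0..1}" for w r
  proof -
    define k where "k = (\<lambda>r. dphi p (y r) * D {0..1} w r)"
    define V where "V = (\<lambda>r. r ^ (n - 1) * k r)"
    have C1_w: "C1_on {0..1} w" and C1_k: "C1_on {0<..1} k"
      and eq_w: "\<And>r. r \<in> {0<..<1} \<Longrightarrow> D {0<..1} k r + (real n - 1) / r * k r + gu r * w r = 0"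
      and w_0: "D {0..1} w 0 = 0" and w_1: "w 1 = 0" and k_0: "(k \<longlongrightarrow> 0) (at_right 0)"
      using lin by (auto simp: linearized_solution_def k_def y_def gu_def)
    have w_deriv: "(w has_real_derivative D {0..1} w r) (at r within {0..1})" if "r \<in> {0..1}" for r
      using C1_on_real(1)[OF C1_w at_within_unit_interval] that by simp
    have V_0: "V 0 = 0" by (simp add: V_def k_def w_0)
    have "continuous (at r within {0..1}) V" if r: "r \<in> {0..1}" for r
    proof (cases "r = 0")
      case True
      have "(V \<longlongrightarrow> 0 ^ (n - 1) * 0) (at_right 0)"
        unfolding V_def by (intro tendsto_intros k_0)
      then show ?thesis
        using V_0 True by (simp add: continuous_within at_within_Icc_at_right)
    next
      case False
      then have r': "r \<in> {0<..1}" using r by auto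
      have "continuous (at r within {0<..1}) k"
        using C1_on_real(1)[OF C1_k, of r] r' at_within_punctured at_within_unit_interval
        by (intro DERIV_continuous) auto
      then show ?thesis
        using at_within_punctured[OF r'] unfolding V_def by (auto intro!: continuous_intros)
    qed
    then have V_cont: "continuous_on {0..1} V" by (simp add: continuous_on_eq_continuous_within)
    have "rs.lin_pair w V"
      unfolding rs.lin_pair_def
    proof (intro conjI ballI V_cont w_1 V_0)
      show "continuous_on {0..1} w" by (rule DERIV_continuous_on[OF w_deriv])
      fix r :: real assume r: "r \<in> {0<..<1}"
      then have r_pos: "r > 0" by simp
      have "V r / (r ^ (n - 1) * dphi p (y r)) = D {0..1} w r"
        using rs.a_pos[OF r] r by (simp add: V_def k_def)
      then show "(w has_real_derivative V r / (r ^ (n - 1) * dphi p (y r))) (at r)"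
        using deriv_at[OF w_deriv r] r by simp
      have k': "D {0<..1} k r = - (real n - 1) / r * k r - gu r * w r"
        using eq_w[OF r] minus[of r "k r"] by linarith
      from DERIV_mult[OF rs.pow_deriv[OF r_pos] flux_deriv[OF C1_k r]]
      show "(V has_real_derivative - (r ^ (n - 1) * gu r * w r)) (at r)"
        unfolding V_def k' by (rule DERIV_cong) (use r in \<open>simp add: field_simps\<close>)
    qed
    then show ?thesis using r by (rule lin_pair_trivial)
  qed
  then show ?thesis using sol by (simp add: non_degenerate_def)
qed

end
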